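(* Let $X_0=m>0$ be a constant. Let $X_1,\dots,X_N$ be independent, continuous real random variables with density functions $f_1,\dots,f_N$ which are continuous with compact support in $[m,\infty)$, and let $\mathbb{X}[q]$ be the random scalar quota complex determined by $X_0,X_1,\dots,X_N$ and quota $q>m>0$. Then for $j\ge1$, $$E[\dim(\bar H_{j-1}(\mathbb{X}[q],\mathbb{Q}))]=\sum_{\mathfrak{J}\subseteq\{1,\dots,N\},\ |\mathfrak{J}|=j}(f_{\mathfrak{J}}\star\mathbb{I}_m)(q)$$ is a continuous function of $q$ with compact support. Furthermore, $$1-E[\chi(\mathbb{X}[q])]=\frac{1}{4\pi^2 i}\int_{-\infty}^{\infty}e^{2\pi i\alpha q}\left(\prod_{j=0}^N(1-\hat f_j(\alpha))-(1-\hat f_0(\alpha))\right)\frac{d\alpha}{\alpha}$$ is a continuous function of $q$ with compact support. (The left-hand sides are defined for $q>m$; the right-hand sides are defined for all real $q$ and are viewed as their extensions to $\mathbb{R}$.)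
   Context: $\mathbb{X}[q]$ is the random simplicial complex on vertices $\{0,1,\dots,N\}$ with weights $w(i)=X_i$: its faces are the nonempty subsets $F\subseteq\{0,\dots,N\}$ with $\sum_{i\in F}X_i<q$. $\bar H$ is reduced homology, $\chi$ is the Euler characteristic (alternating sum of the numbers of faces of each dimension), and $E$ is expectation. Convolution: $(f\star g)(\alpha)=\int_{-\infty}^\infty f(\alpha-x)g(x)\,dx$. For nonempty $\mathfrak{J}\subseteq\{1,\dots,N\}$, $f_{\mathfrak{J}}$ is the convolution of the $f_i$, $i\in\mathfrak{J}$ (equal to $f_i$ if $\mathfrak{J}=\{i\}$). $\mathbb{I}_m$ is the indicator function of $[0,m]$. Fourier transform: $\hat f(\alpha)=\int_{-\infty}^\infty f(x)e^{-2\pi i\alpha x}\,dx$; $f_0$ is the delta measure at $m$, so $\hat f_0(\alpha)=e^{-2\pi i\alpha m}$.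
   Formalization: The constant 1/(4π²i) in the formula for 1−E[χ] is replaced by 1/(2πi): with the stated Fourier transform the printed constant is too small by a factor 2π (e.g. N=1, m=1, triangle density on [1,3], q=2.5 gives −0.75, not −0.75/(2π)). *)

theory Defs
  imports "HOL-Probability.Probability" "HOL-Library.Poly_Mapping"
begin

section \<open>Scalar quota complexes\<close>

definition quota_complex :: "nat \<Rightarrow> (nat \<Rightarrow> real) \<Rightarrow> real \<Rightarrow> nat set set" where
  "quota_complex N w q = {F. F \<noteq> {} \<and> F \<subseteq> {0..N} \<and> (\<Sum>i\<in>F. w i) < q}"

text \<open>A simplicial complex is given by its set of nonempty faces; a face \<open>F\<close> has
  dimension \<open>card F - 1\<close>.\<close>

definition euler_char :: "nat set set \<Rightarrow> int" where
  "euler_char K = (\<Sum>p\<in>(\<lambda>F. card F - 1) ` K. (-1) ^ p * int (card {F \<in> K. card F = Suc p}))"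


section \<open>Reduced simplicial homology over the rationals\<close>

text \<open>Chains are finitely supported rational combinations of faces, and faces are oriented by
  the natural order of their vertices. A 0-face \<open>{v}\<close> is sent by the boundary map to the
  generator \<open>{}\<close> of degree \<open>-1\<close>, so in degree 0 the boundary map is the augmentation and the
  resulting homology is the reduced one.\<close>

type_synonym chain = "nat set \<Rightarrow>\<^sub>0 rat"

definition chains :: "nat set set \<Rightarrow> nat \<Rightarrow> chain set" where
  "chains K p = {c. Poly_Mapping.keys c \<subseteq> {F \<in> K. card F = Suc p}}"

definition boundary :: "chain \<Rightarrow> chain" where
  "boundary c = (\<Sum>F\<in>Poly_Mapping.keys c. \<Sum>v\<in>F.
     Poly_Mapping.single (F - {v}) ((-1) ^ card {u\<in>F. u < v} * Poly_Mapping.lookup c F))"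

definition reduced_cycles :: "nat set set \<Rightarrow> nat \<Rightarrow> chain set" where
  "reduced_cycles K p = {c \<in> chains K p. boundary c = 0}"

definition boundaries :: "nat set set \<Rightarrow> nat \<Rightarrow> chain set" where
  "boundaries K p = boundary ` chains K (Suc p)"

abbreviation chain_scale :: "rat \<Rightarrow> chain \<Rightarrow> chain" where
  "chain_scale a \<equiv> Poly_Mapping.map ((*) a)"

text \<open>\<open>is_quotient_basis Z B d b\<close>: the classes of \<open>b 0, \<dots>, b (d - 1)\<close> form a basis of \<open>Z / B\<close>,
  that is, every class in \<open>Z / B\<close> is a unique rational linear combination of them. The side
  condition \<open>\<forall>i\<ge>d. a i = 0\<close> makes \<open>a\<close> a coefficient vector of length \<open>d\<close>.\<close>

definition is_quotient_basis :: "chain set \<Rightarrow> chain set \<Rightarrow> nat \<Rightarrow> (nat \<Rightarrow> chain) \<Rightarrow> bool" where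
  "is_quotient_basis Z B d b \<longleftrightarrow>
     b ` {..<d} \<subseteq> Z \<and>
     (\<forall>z\<in>Z. \<exists>!a. (\<forall>i\<ge>d. a i = 0) \<and> z - (\<Sum>i<d. chain_scale (a i) (b i)) \<in> B)"

definition quotient_dim :: "chain set \<Rightarrow> chain set \<Rightarrow> nat" where
  "quotient_dim Z B = (THE d. \<exists>b. is_quotient_basis Z B d b)"

definition dim_reduced_homology :: "nat set set \<Rightarrow> nat \<Rightarrow> nat" where
  "dim_reduced_homology K p = quotient_dim (reduced_cycles K p) (boundaries K p)"


section \<open>Convolutions, supports and Fourier transforms\<close>

definition fun_conv :: "(real \<Rightarrow> real) \<Rightarrow> (real \<Rightarrow> real) \<Rightarrow> real \<Rightarrow> real" where
  "fun_conv f g \<alpha> = (\<integral>x. f (\<alpha> - x) * g x \<partial>lborel)"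

text \<open>The value on the empty list is never used.\<close>

fun conv_list :: "(real \<Rightarrow> real) list \<Rightarrow> real \<Rightarrow> real" where
  "conv_list [] = (\<lambda>_. 0)"
| "conv_list [f] = f"
| "conv_list (f # g # fs) = fun_conv f (conv_list (g # fs))"

text \<open>For a nonempty finite index set, the densities are convolved in increasing order of
  their indices; for densities of the kind considered here the order does not matter.\<close>

definition conv_family :: "(nat \<Rightarrow> real \<Rightarrow> real) \<Rightarrow> nat set \<Rightarrow> real \<Rightarrow> real" where
  "conv_family f J = conv_list (map f (sorted_list_of_set J))"

definition fun_support :: "(real \<Rightarrow> 'a::zero) \<Rightarrow> real set" where
  "fun_support g = closure {x. g x \<noteq> 0}"

definition fourier :: "(real \<Rightarrow> real) \<Rightarrow> real \<Rightarrow> complex" where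
  "fourier f \<alpha> = (\<integral>x. complex_of_real (f x) * exp (- 2 * pi * \<i> * \<alpha> * x) \<partial>lborel)"

text \<open>The family of transforms of \<open>f 0, f 1, f 2, \<dots>\<close>, where index 0 stands for the delta
  measure at \<open>m\<close> rather than for a function.

  Normalization: with this transform, that of the indicator of \<open>[0, m]\<close> at \<open>\<alpha> \<noteq> 0\<close> is
  \<open>(1 - fourier_family m f 0 \<alpha>) / (2 * pi * \<i> * \<alpha>)\<close>, and the inverse transform is
  \<open>\<integral>\<alpha>. g \<alpha> * exp (2 * pi * \<i> * \<alpha> * q) \<partial>lborel\<close> without any prefactor. Hence the prefactor in
  \<open>euler_integral\<close> below is \<open>1 / (2 * pi * \<i>)\<close>; the source prints \<open>1 / (4 * pi\<^sup>2 * \<i>)\<close>, which is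
  off by a factor of \<open>2 * pi\<close>.\<close>

definition fourier_family :: "real \<Rightarrow> (nat \<Rightarrow> real \<Rightarrow> real) \<Rightarrow> nat \<Rightarrow> real \<Rightarrow> complex" where
  "fourier_family m f j \<alpha> = (if j = 0 then exp (- 2 * pi * \<i> * \<alpha> * m) else fourier (f j) \<alpha>)"

definition euler_integrand ::
    "nat \<Rightarrow> real \<Rightarrow> (nat \<Rightarrow> real \<Rightarrow> real) \<Rightarrow> real \<Rightarrow> real \<Rightarrow> complex" where
  "euler_integrand N m f q \<alpha> = exp (2 * pi * \<i> * \<alpha> * q) *
     ((\<Prod>j=0..N. 1 - fourier_family m f j \<alpha>) - (1 - fourier_family m f 0 \<alpha>)) / \<alpha>"

definition euler_integral :: "nat \<Rightarrow> real \<Rightarrow> (nat \<Rightarrow> real \<Rightarrow> real) \<Rightarrow> real \<Rightarrow> complex" where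
  "euler_integral N m f q = 1 / (2 * pi * \<i>) * (\<integral>\<alpha>. euler_integrand N m f q \<alpha> \<partial>lborel)"

end

theory Submission
  imports Defs
begin

text \<open>Since every vertex weighs at least \<open>w 0 = m\<close> almost surely, exchanging a vertex of a face for
  the vertex 0 gives a face again. Coning with 0 therefore contracts the chain complex up to the
  faces \<open>J\<close> that avoid 0 and for which \<open>insert 0 J\<close> is not a face, that is, up to the nonempty
  \<open>J \<subseteq> {1..N}\<close> with total weight in \<open>[q - m, q)\<close>. Those with \<open>j\<close> elements count the dimension of
  the homology in degree \<open>j - 1\<close>, and all of them, with signs, give \<open>1 - \<chi>\<close>. The probability that
  a given \<open>J\<close> has such a weight is the convolution of the density of the weight of \<open>J\<close> with the
  indicator of \<open>[0, m]\<close>. For the integral formula, expand the product over subsets of \<open>{1..N}\<close> and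
  apply Levy's inversion formula to every summand; the integrals converge absolutely because the
  characteristic function of a bounded density is square integrable.\<close>

section \<open>Homology by coning with the vertex 0\<close>

text \<open>Three obstacles shape the proof. \<open>quotient_dim\<close> is a definite description,
  so exhibiting a basis of the homology is not enough: every other quotient basis must be shown to
  have the same size. The coordinates at the critical faces serve both purposes, since among cycles
  the boundaries are exactly those on which these coordinates vanish. The integrals over the whole
  line converge delicately. The transform of a continuous density need not be integrable, and the
  kernel \<open>(1 - exp (- 2 * pi * \<i> * \<alpha> * m)) / \<alpha>\<close> decays only like
  \<open>1 / \<alpha>\<close>; but both are square integrable, so their product is integrable. The
  empty subset has no density that could improve the decay: its term is the kernel alone, up to a
  constant the transform of the discontinuous indicator of \<open>[0, m]\<close>, and this is not
  absolutely integrable. This explains why \<open>1 - fourier_family m f 0 \<alpha>\<close> is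
  subtracted from the product.\<close>

lemma lookup_chain_scale: "Poly_Mapping.lookup (chain_scale a c) F = a * Poly_Mapping.lookup c F"
  by (simp add: Poly_Mapping.map.rep_eq when_def)

text \<open>Gives access to the library theory of subspaces, spans and independent sets of chains.
  The scaling appears here as a composition, which \<open>chain_module_sum\<close> translates to
  \<open>chain_scale\<close>.\<close>

interpretation chain: vector_space "Poly_Mapping.map \<circ> (*) :: rat \<Rightarrow> chain \<Rightarrow> chain"
  by unfold_locales
    (auto intro!: poly_mapping_eqI simp: lookup_chain_scale lookup_add algebra_simps)

lemma lookup_single_if:
  "Poly_Mapping.lookup (Poly_Mapping.single k v) k' = (if k = k' then v else 0)"
  by (simp add: lookup_single when_def)

lemma chain_module_sum:
  "(\<Sum>i\<in>I. chain_scale (a i) (b i)) = (\<Sum>i\<in>I. (Poly_Mapping.map \<circ> (*)) (a i) (b i))"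
  by simp

text \<open>A quotient basis is unique in size because the coordinates on \<open>C\<close> identify \<open>Z / B\<close>
  with the span of the elements of \<open>C\<close>.\<close>

lemma quotient_dim_eqI:
  fixes C :: "nat set set"
  assumes fin: "finite C"
    and sub: "chain.subspace Z"
    and B: "\<And>z. z \<in> Z \<Longrightarrow> z \<in> B \<longleftrightarrow> (\<forall>J\<in>C. Poly_Mapping.lookup z J = 0)"
    and e: "\<And>J. J \<in> C \<Longrightarrow> e J \<in> Z"
    and lookup_e: "\<And>J J'. J \<in> C \<Longrightarrow> J' \<in> C \<Longrightarrow>
              Poly_Mapping.lookup (e J) J' = (if J = J' then 1 else 0)"
  shows "quotient_dim Z B = card C"
  unfolding quotient_dim_def
proof (rule the_equality)
  have comb: "(\<Sum>i\<in>I. chain_scale (a i) (b i)) \<in> Z"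
    if "\<And>i. i \<in> I \<Longrightarrow> b i \<in> Z" for I :: "nat set" and a b
    unfolding chain_module_sum
    by (intro chain.subspace_sum[OF sub] chain.subspace_scale[OF sub] that)
  obtain g where g: "bij_betw g {..<card C} C"
    using ex_bij_betw_nat_finite[OF fin] by (auto simp: atLeast0LessThan)
  define b where "b = e \<circ> g"
  have bZ: "b i \<in> Z" if "i < card C" for i
    using that g by (auto simp: b_def bij_betw_def intro!: e)
  have lookup_comb: "Poly_Mapping.lookup (\<Sum>i<card C. chain_scale (a i) (b i)) (g k) = a k"
    if "k < card C" for a k
  proof -
    have "Poly_Mapping.lookup (\<Sum>i<card C. chain_scale (a i) (b i)) (g k)
      = (\<Sum>i<card C. a i * (if i = k then 1 else 0))"
      unfolding lookup_sum lookup_chain_scale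
    proof (intro sum.cong refl arg_cong2[where f="(*)"])
      fix i assume "i \<in> {..<card C}"
      then show "Poly_Mapping.lookup (b i) (g k) = (if i = k then 1 else 0)"
        using that g lookup_e[of "g i" "g k"]
        by (simp add: b_def bij_betwE inj_on_eq_iff[OF bij_betw_imp_inj_on[OF g]])
    qed
    then show ?thesis using that by (simp add: if_distrib cong: if_cong)
  qed
  \<comment> \<open>Subtracting a combination lands in \<open>B\<close> exactly when its
    coefficients are the coordinates of \<open>z\<close> on \<open>C\<close>; existence and
    uniqueness of \<open>a\<close> are both read off from this.\<close>
  have mem: "z - (\<Sum>i<card C. chain_scale (a i) (b i)) \<in> B \<longleftrightarrow>
      (\<forall>k<card C. a k = Poly_Mapping.lookup z (g k))" if "z \<in> Z" for z a
  proof -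
    have "z - (\<Sum>i<card C. chain_scale (a i) (b i)) \<in> Z"
      by (intro chain.subspace_diff[OF sub] that comb bZ) auto
    then have "?thesis \<longleftrightarrow> (\<forall>J\<in>g ` {..<card C}. Poly_Mapping.lookup
        (z - (\<Sum>i<card C. chain_scale (a i) (b i))) J = 0) = (\<forall>k<card C. a k = Poly_Mapping.lookup z (g k))"
      using B bij_betw_imp_surj_on[OF g] by simp
    then show ?thesis
      by (auto simp: lookup_minus lookup_comb)
  qed
  have "is_quotient_basis Z B (card C) b"
    unfolding is_quotient_basis_def
  proof (intro conjI ballI)
    show "b ` {..<card C} \<subseteq> Z" using bZ by auto
    fix z assume z: "z \<in> Z"
    show "\<exists>!a. (\<forall>i\<ge>card C. a i = 0) \<and> z - (\<Sum>i<card C. chain_scale (a i) (b i)) \<in> B"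
      unfolding mem[OF z]
    proof (rule ex1I)
      show "(\<forall>i\<ge>card C. (if i < card C then Poly_Mapping.lookup z (g i) else 0) = 0) \<and>
         (\<forall>k<card C. (if k < card C then Poly_Mapping.lookup z (g k) else 0) = Poly_Mapping.lookup z (g k))"
        by auto
    next
      fix a assume "(\<forall>i\<ge>card C. a i = 0) \<and> (\<forall>k<card C. a k = Poly_Mapping.lookup z (g k))"
      then show "a = (\<lambda>i. if i < card C then Poly_Mapping.lookup z (g i) else 0)"
        by (auto simp: fun_eq_iff)
    qed
  qed
  then show "\<exists>b. is_quotient_basis Z B (card C) b" by blast

  fix d assume "\<exists>b. is_quotient_basis Z B d b"
  then obtain b where qb: "is_quotient_basis Z B d b" ..
  have b: "b ` {..<d} \<subseteq> Z"
    using qb unfolding is_quotient_basis_def by (rule conjunct1)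
  have ex1: "\<exists>!a. (\<forall>i\<ge>d. a i = 0) \<and> z - (\<Sum>i<d. chain_scale (a i) (b i)) \<in> B"
    if "z \<in> Z" for z
    using qb that unfolding is_quotient_basis_def by simp
  have unique: "a = a'"
    if z: "z \<in> Z"
      and "(\<forall>i\<ge>d. a i = 0) \<and> z - (\<Sum>i<d. chain_scale (a i) (b i)) \<in> B"
      and "(\<forall>i\<ge>d. a' i = 0) \<and> z - (\<Sum>i<d. chain_scale (a' i) (b i)) \<in> B"
    for z a a'
    by (rule ex1E[OF ex1[OF z]]) (use that(2,3) in metis)
  \<comment> \<open>\<open>\<pi>\<close> forgets all coordinates outside \<open>C\<close>. On
    \<open>Z\<close> its kernel is \<open>B\<close>, so it models the quotient inside the space of
    chains, where sizes of bases can be compared.\<close>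
  define \<pi> :: "chain \<Rightarrow> chain" where
    "\<pi> z = (\<Sum>J\<in>C. Poly_Mapping.single J (Poly_Mapping.lookup z J))" for z
  have lookup_\<pi>: "Poly_Mapping.lookup (\<pi> z) J = (if J \<in> C then Poly_Mapping.lookup z J else 0)" for z J
    using fin by (simp add: \<pi>_def lookup_sum lookup_single_if)
  have \<pi>_comb: "\<pi> (\<Sum>i\<in>I. chain_scale (a i) (b i)) = (\<Sum>i\<in>I. chain_scale (a i) (\<pi> (b i)))"
    for a I and b :: "nat \<Rightarrow> chain"
    by (rule poly_mapping_eqI) (simp add: lookup_\<pi> lookup_sum lookup_chain_scale)
  have \<pi>_diff: "\<pi> (x - y) = \<pi> x - \<pi> y" for x y
    by (rule poly_mapping_eqI) (simp add: lookup_\<pi> lookup_minus)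
  have \<pi>0: "\<pi> z = 0 \<longleftrightarrow> z \<in> B" if "z \<in> Z" for z
    using B[OF that] by (auto simp: poly_mapping_eq_iff fun_eq_iff lookup_\<pi>)
  have indep: "\<forall>i<d. a i = 0" if 0: "(\<Sum>i<d. chain_scale (a i) (\<pi> (b i))) = 0" for a
  proof -
    \<comment> \<open>Uniqueness is available only for coefficient vectors that vanish from
      \<open>d\<close> on, so \<open>a\<close> is cut off before it is compared with the zero
      vector. Both represent the class of \<open>?z\<close>.\<close>
    let ?a = "\<lambda>i. if i < d then a i else 0" and ?z = "\<Sum>i<d. chain_scale (a i) (b i)"
    have z: "?z \<in> Z" using b by (intro comb) auto
    have "0 \<in> B" using B[OF chain.subspace_0[OF sub]] by simp
    then have "(\<forall>i\<ge>d. ?a i = 0) \<and> ?z - (\<Sum>i<d. chain_scale (?a i) (b i)) \<in> B"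
      by simp
    moreover have "(\<forall>i\<ge>d. (\<lambda>_. 0) i = 0) \<and> ?z - (\<Sum>i<d. chain_scale ((\<lambda>_. 0) i) (b i)) \<in> B"
    proof -
      have "(\<Sum>i<d. chain_scale ((\<lambda>_. 0) i) (b i)) = 0"
        by (rule poly_mapping_eqI) (simp add: lookup_sum lookup_chain_scale)
      then show ?thesis using 0 \<pi>0[OF z] \<pi>_comb by simp
    qed
    ultimately have "?a = (\<lambda>_. 0)" by (rule unique[OF z])
    then show ?thesis by (auto simp: fun_eq_iff split: if_splits)
  qed
  \<comment> \<open>Library independence speaks about sets, so repetitions have to be excluded
    first: one would be a relation with coefficients 1 and -1.\<close>
  have inj: "inj_on (\<pi> \<circ> b) {..<d}"
  proof (rule inj_onI, rule ccontr)
    fix i j assume ij: "i \<in> {..<d}" "j \<in> {..<d}" "(\<pi> \<circ> b) i = (\<pi> \<circ> b) j" "i \<noteq> j"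
    let ?a = "\<lambda>k. if k = i then 1 else if k = j then -1 else (0::rat)"
    have "(\<Sum>k<d. chain_scale (?a k) (\<pi> (b k))) =
      (\<Sum>k\<in>{i,j}. chain_scale (?a k) (\<pi> (b k)))"
      using ij by (intro sum.mono_neutral_right)
        (auto intro!: poly_mapping_eqI simp: lookup_chain_scale)
    also have "\<dots> = 0" using ij
      by (auto intro!: poly_mapping_eqI simp: lookup_chain_scale lookup_add)
    finally have "?a i = 0" using indep[of ?a] ij by blast
    then show False by simp
  qed
  have ind: "chain.independent ((\<pi> \<circ> b) ` {..<d})"
  proof -
    have "\<forall>x\<in>(\<pi> \<circ> b) ` {..<d}. u x = 0"
      if "(\<Sum>v\<in>(\<pi> \<circ> b) ` {..<d}. (Poly_Mapping.map \<circ> (*)) (u v) v) = 0" for u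
    proof -
      have "(\<Sum>i<d. chain_scale ((u \<circ> \<pi> \<circ> b) i) (\<pi> (b i))) = 0"
        using that unfolding sum.reindex[OF inj] by simp
      then show ?thesis by (auto dest: indep)
    qed
    then show ?thesis
      by (subst chain.independent_if_scalars_zero) auto
  qed
  let ?s = "\<lambda>J. Poly_Mapping.single J (1::rat)"
  have injs: "inj_on ?s C"
    by (rule inj_onI) (auto dest: arg_cong[where f=Poly_Mapping.keys])
  have inds: "chain.independent (?s ` C)"
  proof -
    have "\<forall>x\<in>?s ` C. u x = 0"
      if "(\<Sum>v\<in>?s ` C. (Poly_Mapping.map \<circ> (*)) (u v) v) = 0" for u
    proof safe
      fix J assume "J \<in> C"
      have "Poly_Mapping.lookup (\<Sum>v\<in>?s ` C. (Poly_Mapping.map \<circ> (*)) (u v) v) J = u (?s J)"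
        using fin \<open>J \<in> C\<close>
        by (simp add: sum.reindex[OF injs] lookup_sum lookup_chain_scale lookup_single_if if_distrib cong: if_cong)
      then show "u (?s J) = 0" using that by simp
    qed
    then show ?thesis
      using fin by (intro chain.independent_if_scalars_zero) auto
  qed
  have span: "chain.span ((\<pi> \<circ> b) ` {..<d}) = chain.span (?s ` C)"
  proof (rule antisym)
    have "\<pi> z \<in> chain.span (?s ` C)" for z
    proof -
      have "\<pi> z = (\<Sum>J\<in>C. (Poly_Mapping.map \<circ> (*)) (Poly_Mapping.lookup z J) (?s J))"
        unfolding \<pi>_def by (intro sum.cong refl poly_mapping_eqI)
          (simp add: lookup_chain_scale lookup_single_if)
      also have "\<dots> \<in> chain.span (?s ` C)"
        by (intro chain.span_sum chain.span_scale chain.span_base) auto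
      finally show ?thesis .
    qed
    then show "chain.span ((\<pi> \<circ> b) ` {..<d}) \<subseteq> chain.span (?s ` C)"
      by (intro chain.span_minimal) auto
    have "?s J \<in> chain.span ((\<pi> \<circ> b) ` {..<d})" if J: "J \<in> C" for J
    proof -
      obtain a where a: "e J - (\<Sum>i<d. chain_scale (a i) (b i)) \<in> B"
        using ex1[OF e[OF J]] by blast
      have "(\<Sum>i<d. chain_scale (a i) (b i)) \<in> Z" using b by (intro comb) auto
      then have "e J - (\<Sum>i<d. chain_scale (a i) (b i)) \<in> Z"
        by (intro chain.subspace_diff[OF sub] e J)
      then have "\<pi> (e J - (\<Sum>i<d. chain_scale (a i) (b i))) = 0"
        using a \<pi>0 by blast
      then have "\<pi> (e J) = \<pi> (\<Sum>i<d. chain_scale (a i) (b i))"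
        by (simp add: \<pi>_diff)
      moreover have "\<pi> (e J) = ?s J"
        using J by (auto intro!: poly_mapping_eqI simp: lookup_\<pi> lookup_e lookup_single_if)
      ultimately have "?s J = (\<Sum>i<d. (Poly_Mapping.map \<circ> (*)) (a i) ((\<pi> \<circ> b) i))"
        by (simp add: \<pi>_comb)
      also have "\<dots> \<in> chain.span ((\<pi> \<circ> b) ` {..<d})"
        by (intro chain.span_sum chain.span_scale chain.span_base) auto
      finally show ?thesis .
    qed
    then show "chain.span (?s ` C) \<subseteq> chain.span ((\<pi> \<circ> b) ` {..<d})"
      by (intro chain.span_minimal) auto
  qed
  have "card ((\<pi> \<circ> b) ` {..<d}) = card (?s ` C)"
    using chain.bij_if_span_eq_span_bases[OF ind inds span] bij_betw_same_card by blast
  then show "d = card C"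
    unfolding card_image[OF inj] card_image[OF injs] by simp
qed

text \<open>The sign is attached to the face \<open>G\<close> that remains after \<open>v\<close> is
  removed. As \<open>v\<close> is not below itself, counting in \<open>G\<close> or in
  \<open>insert v G\<close> gives the same sign.\<close>

definition vertex_sign :: "nat \<Rightarrow> nat set \<Rightarrow> rat" where
  "vertex_sign v G = (-1) ^ card {u\<in>G. u < v}"

text \<open>Regroups the boundary by its target: the faces with facet \<open>G\<close> are the sets
  \<open>insert v G\<close> with \<open>v\<close> outside \<open>G\<close>. Summing over a fixed
  \<open>U\<close> instead of the support of \<open>c\<close> makes linearity of the boundary a
  termwise matter.\<close>

lemma lookup_boundary:
  assumes U: "finite U" and keys: "Poly_Mapping.keys c \<subseteq> Pow U"
  shows "Poly_Mapping.lookup (boundary c) G =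
    (\<Sum>v\<in>U - G. vertex_sign v G * Poly_Mapping.lookup c (insert v G))"
proof -
  have sign: "(-1) ^ card {u\<in>F. u < v} = vertex_sign v (F - {v})" for v F
    unfolding vertex_sign_def by (rule arg_cong[where f="\<lambda>A. (-1) ^ card A"]) auto
  have finF: "finite F" if "F \<in> Poly_Mapping.keys c" for F
    using that keys U by (auto intro: finite_subset)
  have vU: "v \<in> U" if "F \<in> Poly_Mapping.keys c" "v \<in> F" for F v
    using that keys by blast
  have "Poly_Mapping.lookup (boundary c) G =
    (\<Sum>F\<in>Poly_Mapping.keys c. \<Sum>v\<in>F.
      if F - {v} = G then vertex_sign v (F - {v}) * Poly_Mapping.lookup c F else 0)"
    by (simp add: boundary_def lookup_sum lookup_single_if sign)
  also have "\<dots> = (\<Sum>(F, v)\<in>(SIGMA F:Poly_Mapping.keys c. F).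
      if F - {v} = G then vertex_sign v (F - {v}) * Poly_Mapping.lookup c F else 0)"
    by (rule sum.Sigma) (use finF in auto)
  also have "\<dots> = (\<Sum>(F, v)\<in>{(F, v). F \<in> Poly_Mapping.keys c \<and> v \<in> F \<and> F - {v} = G}.
      vertex_sign v G * Poly_Mapping.lookup c F)"
  proof (rule sum.mono_neutral_cong_right)
    show "finite (SIGMA F:Poly_Mapping.keys c. F)" using finF by auto
  qed (auto split: if_splits)
  also have "\<dots> = (\<Sum>v\<in>{v\<in>U - G. insert v G \<in> Poly_Mapping.keys c}.
      vertex_sign v G * Poly_Mapping.lookup c (insert v G))"
  proof (rule sum.reindex_bij_witness[where i="\<lambda>v. (insert v G, v)" and j=snd])
  qed (use vU in \<open>auto simp: insert_absorb\<close>)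
  also have "\<dots> = (\<Sum>v\<in>U - G. vertex_sign v G * Poly_Mapping.lookup c (insert v G))"
    using U by (intro sum.mono_neutral_left) (auto simp: in_keys_iff)
  finally show ?thesis .
qed

lemma keys_boundary_subset:
  "Poly_Mapping.keys (boundary c) \<subseteq> (\<Union>F\<in>Poly_Mapping.keys c. (\<lambda>v. F - {v}) ` F)"
proof
  fix G assume "G \<in> Poly_Mapping.keys (boundary c)"
  then have "(\<Sum>F\<in>Poly_Mapping.keys c. \<Sum>v\<in>F. Poly_Mapping.lookup (Poly_Mapping.single (F - {v})
      ((-1) ^ card {u\<in>F. u < v} * Poly_Mapping.lookup c F)) G) \<noteq> 0"
    by (simp add: in_keys_iff boundary_def lookup_sum)
  then obtain F where F: "F \<in> Poly_Mapping.keys c" and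
    "(\<Sum>v\<in>F. Poly_Mapping.lookup (Poly_Mapping.single (F - {v})
      ((-1) ^ card {u\<in>F. u < v} * Poly_Mapping.lookup c F)) G) \<noteq> 0"
    by (rule sum.not_neutral_contains_not_neutral)
  then obtain v where "v \<in> F" "Poly_Mapping.lookup (Poly_Mapping.single (F - {v})
      ((-1) ^ card {u\<in>F. u < v} * Poly_Mapping.lookup c F)) G \<noteq> 0"
    using sum.not_neutral_contains_not_neutral by blast
  with F show "G \<in> (\<Union>F\<in>Poly_Mapping.keys c. (\<lambda>v. F - {v}) ` F)"
    by (auto simp: lookup_single_if split: if_splits)
qed

lemma vertex_sign_insert:
  assumes "finite G" "v \<notin> G"
  shows "vertex_sign w (insert v G) = (if v < w then - vertex_sign w G else vertex_sign w G)"
proof (cases "v < w")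
  case True
  then have "{u \<in> insert v G. u < w} = insert v {u\<in>G. u < w}" by auto
  then show ?thesis using assms True by (simp add: vertex_sign_def)
next
  case False
  then have "{u \<in> insert v G. u < w} = {u\<in>G. u < w}" by auto
  then show ?thesis using False by (simp add: vertex_sign_def)
qed

text \<open>Two vertices can be adjoined to \<open>G\<close> in two orders, and the order changes
  the product of the signs by -1. Swapping the pairs shows that the sum equals its own
  negative.\<close>

lemma boundary_boundary:
  assumes U: "finite U" and keys: "Poly_Mapping.keys c \<subseteq> Pow U"
  shows "boundary (boundary c) = 0"
proof (rule poly_mapping_eqI)
  fix G
  have keys': "Poly_Mapping.keys (boundary c) \<subseteq> Pow U"
    using keys_boundary_subset[of c] keys by blast
  let ?g = "\<lambda>(v, w). vertex_sign v G * (vertex_sign w (insert v G) *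
    Poly_Mapping.lookup c (insert w (insert v G)))"
  let ?P = "SIGMA v:U - G. U - insert v G"
  have *: "Poly_Mapping.lookup (boundary (boundary c)) G = sum ?g ?P"
    unfolding lookup_boundary[OF U keys'] lookup_boundary[OF U keys] sum_distrib_left
    by (rule sum.Sigma) (use U in auto)
  have "Poly_Mapping.lookup (boundary (boundary c)) G = 0"
  proof (cases "finite G")
    case True
    have "sum ?g ?P = sum (\<lambda>p. - ?g p) ?P"
    proof (rule sum.reindex_bij_witness[where i=prod.swap and j=prod.swap])
      fix p assume "p \<in> ?P"
      then obtain v w where "p = (v, w)" "v \<notin> G" "w \<notin> G" "v \<noteq> w" by auto
      then show "- ?g (prod.swap p) = ?g p"
        using True by (cases v w rule: linorder_cases)
          (simp_all add: vertex_sign_insert insert_commute)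
    qed auto
    then show ?thesis unfolding * by (simp add: sum_negf)
  next
    \<comment> \<open>An infinite \<open>G\<close> has no superset inside \<open>U\<close>, so no
      coefficient of \<open>c\<close> contributes.\<close>
    case False
    then have "\<not> insert w (insert v G) \<subseteq> U" for v w
      using finite_subset[OF _ U, of "insert w (insert v G)"] by auto
    then have "insert w (insert v G) \<notin> Poly_Mapping.keys c" for v w
      using keys by blast
    then show ?thesis unfolding * by (intro sum.neutral) (auto simp: in_keys_iff)
  qed
  then show "Poly_Mapping.lookup (boundary (boundary c)) G = Poly_Mapping.lookup 0 G" by simp
qed

text \<open>In the language of discrete Morse theory: the faces avoiding 0 that stay unmatched when
  \<open>F\<close> is paired with \<open>insert 0 F\<close>.\<close>

definition critical_faces :: "nat set set \<Rightarrow> nat set set" where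
  "critical_faces K = {J \<in> K. 0 \<notin> J \<and> insert 0 J \<notin> K}"

text \<open>Adjoining the vertex 0 is a contraction of the chain complex wherever it is defined, and the
  boundaries of the missing cones \<open>insert 0 J\<close> over the critical faces \<open>J\<close> represent a basis
  of the homology.\<close>

lemma dim_reduced_homology_eq_card_critical:
  assumes U: "finite U" "K \<subseteq> Pow U" "0 \<in> U"
    and exchange: "\<And>F v. F \<in> K \<Longrightarrow> 0 \<notin> F \<Longrightarrow> v \<in> F \<Longrightarrow> insert 0 (F - {v}) \<in> K"
  shows "dim_reduced_homology K p = card {J \<in> critical_faces K. card J = Suc p}"
  unfolding dim_reduced_homology_def
proof (rule quotient_dim_eqI)
  let ?C = "{J \<in> critical_faces K. card J = Suc p}"
  let ?e = "\<lambda>J. boundary (Poly_Mapping.single (insert 0 J) (1::rat))"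
  have chainU: "Poly_Mapping.keys c \<subseteq> Pow U" if "c \<in> chains K n" for c n
    using that U by (auto simp: chains_def)
  have finK: "finite F" if "F \<in> K" for F
    using that U by (auto intro: finite_subset)
  show "finite ?C"
    using U by (intro finite_subset[of ?C "Pow U"]) (auto simp: critical_faces_def)
  show "chain.subspace (reduced_cycles K p)"
  proof (rule chain.subspaceI)
    show "0 \<in> reduced_cycles K p"
      by (simp add: reduced_cycles_def chains_def boundary_def)
  next
    fix x y assume "x \<in> reduced_cycles K p" "y \<in> reduced_cycles K p"
    then have xy: "x \<in> chains K p" "y \<in> chains K p" "boundary x = 0" "boundary y = 0"
      by (auto simp: reduced_cycles_def)
    then have s: "x + y \<in> chains K p"
      using Poly_Mapping.keys_add[of x y] by (auto simp: chains_def)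
    have "boundary (x + y) = boundary x + boundary y"
      by (rule poly_mapping_eqI)
        (simp add: lookup_boundary[OF U(1) chainU[OF s]] lookup_boundary[OF U(1) chainU[OF xy(1)]]
          lookup_boundary[OF U(1) chainU[OF xy(2)]] lookup_add distrib_left sum.distrib)
    with s xy show "x + y \<in> reduced_cycles K p" by (simp add: reduced_cycles_def)
  next
    fix a x assume "x \<in> reduced_cycles K p"
    then have x: "x \<in> chains K p" "boundary x = 0"
      by (auto simp: reduced_cycles_def)
    then have s: "chain_scale a x \<in> chains K p"
      by (auto simp: chains_def in_keys_iff lookup_chain_scale)
    have "boundary (chain_scale a x) = chain_scale a (boundary x)"
      by (rule poly_mapping_eqI) (simp add: lookup_boundary[OF U(1) chainU[OF s]]
        lookup_boundary[OF U(1) chainU[OF x(1)]]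
        lookup_chain_scale sum_distrib_left algebra_simps)
    with s x chain.scale_zero_right[of a] show "(Poly_Mapping.map \<circ> (*)) a x \<in> reduced_cycles K p"
      by (simp add: reduced_cycles_def)
  qed
  \<comment> \<open>The cone \<open>insert 0 J\<close> is missing from \<open>K\<close>, but all its
    facets are there: removing 0 leaves \<open>J\<close>, and removing another vertex leaves an
    exchanged face.\<close>
  show "?e J \<in> reduced_cycles K p" if "J \<in> ?C" for J
  proof -
    have J: "J \<in> K" "0 \<notin> J" "card J = Suc p" using that by (auto simp: critical_faces_def)
    note finK[OF J(1)]
    have k: "Poly_Mapping.keys (Poly_Mapping.single (insert 0 J) (1::rat)) = {insert 0 J}" by simp
    have "Poly_Mapping.keys (?e J) \<subseteq> {F \<in> K. card F = Suc p}"
    proof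
      fix G assume "G \<in> Poly_Mapping.keys (?e J)"
      then obtain v where v: "v \<in> insert 0 J" "G = insert 0 J - {v}"
        using keys_boundary_subset[of "Poly_Mapping.single (insert 0 J) (1::rat)"] by auto
      show "G \<in> {F \<in> K. card F = Suc p}"
      proof (cases "v = 0")
        case True
        then show ?thesis using v J by simp
      next
        case False
        then have "G = insert 0 (J - {v})" "v \<in> J" using v by auto
        then show ?thesis using exchange[OF J(1,2)] J \<open>finite J\<close> by simp
      qed
    qed
    moreover have "boundary (?e J) = 0"
      using U J by (intro boundary_boundary[of U]) auto
    ultimately show ?thesis by (simp add: reduced_cycles_def chains_def)
  qed
  \<comment> \<open>\<open>J\<close> is the only facet of \<open>insert 0 J\<close> that avoids 0,
    and its sign is 1 because no vertex lies below 0.\<close>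
  show "Poly_Mapping.lookup (?e J) J' = (if J = J' then 1 else 0)" if "J \<in> ?C" "J' \<in> ?C" for J J'
  proof -
    have J: "J \<in> K" "0 \<notin> J" "J' \<in> K" "0 \<notin> J'" using that by (auto simp: critical_faces_def)
    have "Poly_Mapping.lookup (?e J) J' = (\<Sum>v\<in>U - J'.
        vertex_sign v J' * (if insert 0 J = insert v J' then 1 else 0))"
      using U J by (subst lookup_boundary[of U]) (auto simp: lookup_single_if)
    also have "\<dots> = (\<Sum>v\<in>U - J'. if v = 0 then (if J = J' then 1 else 0) else 0)"
    proof (intro sum.cong refl)
      fix v assume "v \<in> U - J'"
      have "insert 0 J = insert v J' \<longleftrightarrow> v = 0 \<and> J = J'"
      proof
        assume eq: "insert 0 J = insert v J'"
        have "0 \<in> insert v J'" unfolding eq[symmetric] by simp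
        then have "v = 0" using J(4) by simp
        then show "v = 0 \<and> J = J'" using eq insert_ident[OF J(2,4)] by simp
      qed simp
      then show "vertex_sign v J' * (if insert 0 J = insert v J' then 1 else 0) =
          (if v = 0 then if J = J' then 1 else 0 else 0)"
        by (simp add: vertex_sign_def)
    qed
    also have "\<dots> = (if J = J' then 1 else 0)"
      using U J by simp
    finally show ?thesis .
  qed
  show "z \<in> boundaries K p \<longleftrightarrow> (\<forall>J\<in>?C. Poly_Mapping.lookup z J = 0)" if z: "z \<in> reduced_cycles K p" for z
  proof
    assume "z \<in> boundaries K p"
    then obtain c where c: "c \<in> chains K (Suc p)" "z = boundary c"
      by (auto simp: boundaries_def)
    show "\<forall>J\<in>?C. Poly_Mapping.lookup z J = 0"
    proof
      fix J assume J: "J \<in> ?C"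
      \<comment> \<open>A critical face has no coface in \<open>K\<close> at all: exchanging
        \<open>v\<close> for 0 in a coface \<open>insert v J\<close> would produce the missing
        \<open>insert 0 J\<close>.\<close>
      have "insert v J \<notin> Poly_Mapping.keys c" if "v \<notin> J" for v
      proof
        assume "insert v J \<in> Poly_Mapping.keys c"
        then have "insert v J \<in> K" using c by (auto simp: chains_def)
        with exchange[of "insert v J" v] J that show False
          by (cases "v = 0") (auto simp: critical_faces_def)
      qed
      then show "Poly_Mapping.lookup z J = 0"
        unfolding c(2) lookup_boundary[OF U(1) chainU[OF c(1)]]
        by (intro sum.neutral) (auto simp: in_keys_iff)
    qed
  next
    assume crit: "\<forall>J\<in>?C. Poly_Mapping.lookup z J = 0"
    have zc: "z \<in> chains K p" and z0: "boundary z = 0"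
      using z by (auto simp: reduced_cycles_def)
    \<comment> \<open>The cone with apex 0 over those faces of \<open>z\<close> that avoid 0.
      Vanishing of \<open>z\<close> on the critical faces is what puts these cones into
      \<open>K\<close>.\<close>
    let ?w = "\<lambda>F. if 0 \<in> F then Poly_Mapping.lookup z (F - {0}) else 0"
    define w where "w = Abs_poly_mapping ?w"
    have "{F. ?w F \<noteq> 0} \<subseteq> insert 0 ` Poly_Mapping.keys z"
    proof
      fix F assume "F \<in> {F. ?w F \<noteq> 0}"
      then have "F = insert 0 (F - {0})" "F - {0} \<in> Poly_Mapping.keys z"
        by (auto simp: in_keys_iff split: if_splits)
      then show "F \<in> insert 0 ` Poly_Mapping.keys z" by (rule image_eqI)
    qed
    then have "finite {F. ?w F \<noteq> 0}" by (rule finite_subset) simp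
    then have lookup_w: "Poly_Mapping.lookup w = ?w"
      unfolding w_def by simp
    have w: "w \<in> chains K (Suc p)"
      unfolding chains_def
    proof safe
      fix F assume "F \<in> Poly_Mapping.keys w"
      then have F: "0 \<in> F" "Poly_Mapping.lookup z (F - {0}) \<noteq> 0"
        by (auto simp: in_keys_iff lookup_w split: if_splits)
      then have J: "F - {0} \<in> K" "card (F - {0}) = Suc p"
        using zc by (auto simp: chains_def in_keys_iff)
      then show "F \<in> K" using crit F unfolding critical_faces_def
        by (auto simp: insert_absorb)
      show "card F = Suc (Suc p)" using J F finK[OF J(1)]
        by (metis card_Suc_Diff1 finite_Diff2 finite.emptyI finite_insert)
    qed
    have "boundary w = z"
    proof (rule poly_mapping_eqI)
      fix G
      show "Poly_Mapping.lookup (boundary w) G = Poly_Mapping.lookup z G"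
      proof (cases "0 \<in> G")
        case False
        have "Poly_Mapping.lookup (boundary w) G =
            (\<Sum>v\<in>U - G. if v = 0 then Poly_Mapping.lookup z G else 0)"
          unfolding lookup_boundary[OF U(1) chainU[OF w]] using False
          by (intro sum.cong refl) (auto simp: vertex_sign_def lookup_w)
        also have "\<dots> = Poly_Mapping.lookup z G" using False U by simp
        finally show ?thesis .
      next
        case True
        \<comment> \<open>Here the cycle condition enters, read at \<open>L\<close>: the coface
          \<open>insert 0 L\<close> is \<open>G\<close>, and the other cofaces give minus the terms
          of \<open>boundary w\<close> at \<open>G\<close>. For \<open>G = {0}\<close> this is the
          augmentation condition of reduced homology.\<close>
        define L where "L = G - {0}"
        have G: "G = insert 0 L" "0 \<notin> L" using True by (auto simp: L_def)
        have UL: "U - L = insert 0 (U - G)" "0 \<notin> U - G" using G U by auto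
        show ?thesis
        proof (cases "finite L")
          case False
          then have "\<not> insert v L \<subseteq> U" for v
            using finite_subset[OF _ U(1), of "insert v L"] by auto
          then have "insert v L \<notin> Poly_Mapping.keys z" for v
            using chainU[OF zc] by blast
          moreover have "G - {0} = L" "insert v G - {0} = insert v L" if "v \<noteq> 0" for v
            using G that by auto
          ultimately show ?thesis
            unfolding lookup_boundary[OF U(1) chainU[OF w]] using True G
            by (subst sum.neutral) (auto simp: lookup_w in_keys_iff)
        next
          case True
          have "Poly_Mapping.lookup (boundary w) G =
              (\<Sum>v\<in>U - G. - (vertex_sign v L * Poly_Mapping.lookup z (insert v L)))"
            unfolding lookup_boundary[OF U(1) chainU[OF w]]
          proof (intro sum.cong refl)
            fix v assume "v \<in> U - G"
            moreover from this have "insert v G - {0} = insert v L" using G by auto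
            ultimately show "vertex_sign v G * Poly_Mapping.lookup w (insert v G) =
                - (vertex_sign v L * Poly_Mapping.lookup z (insert v L))"
              using G True by (simp add: vertex_sign_insert lookup_w)
          qed
          moreover have "0 = Poly_Mapping.lookup (boundary z) L" by (simp add: z0)
          then have "0 = Poly_Mapping.lookup z G +
              (\<Sum>v\<in>U - G. vertex_sign v L * Poly_Mapping.lookup z (insert v L))"
            unfolding lookup_boundary[OF U(1) chainU[OF zc]] UL(1)
            using UL(2) U(1) G by (subst (asm) sum.insert) (auto simp: vertex_sign_def)
          ultimately show ?thesis by (simp add: sum_negf)
        qed
      qed
    qed
    with w show "z \<in> boundaries K p" unfolding boundaries_def by blast
  qed
qed

section \<open>Euler characteristic by the same matching\<close>

lemma euler_char_eq_sum:
  assumes "finite K" "\<And>F. F \<in> K \<Longrightarrow> finite F \<and> F \<noteq> {}"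
  shows "euler_char K = (\<Sum>F\<in>K. (-1) ^ (card F - 1))"
proof -
  have "(\<Sum>F\<in>K. (-1) ^ (card F - 1)) =
      (\<Sum>p\<in>(\<lambda>F. card F - 1) ` K. \<Sum>F\<in>{F\<in>K. card F - 1 = p}. (-1::int) ^ (card F - 1))"
    using assms(1) by (rule sum.image_gen)
  also have "\<dots> = (\<Sum>p\<in>(\<lambda>F. card F - 1) ` K. (-1) ^ p * int (card {F \<in> K. card F = Suc p}))"
  proof (intro sum.cong refl)
    fix p
    have "{F\<in>K. card F - 1 = p} = {F \<in> K. card F = Suc p}"
      using assms(2) by (force simp: card_gt_0_iff dest: card_0_eq)
    moreover have "(\<Sum>F\<in>{F\<in>K. card F = Suc p}. (-1::int) ^ (card F - 1)) =
        (\<Sum>F\<in>{F\<in>K. card F = Suc p}. (-1) ^ p)"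
      by (intro sum.cong) auto
    ultimately show "(\<Sum>F\<in>{F\<in>K. card F - 1 = p}. (-1::int) ^ (card F - 1)) =
        (-1) ^ p * int (card {F \<in> K. card F = Suc p})"
      by simp
  qed
  finally show ?thesis by (simp add: euler_char_def)
qed

text \<open>The signs of \<open>L\<close> and \<open>insert 0 L\<close> cancel. What is left is
  \<open>{0}\<close>, which contributes the 1, and the critical faces, whose sign flips because the
  dimension is one less than the cardinality.\<close>

lemma euler_char_eq_sum_critical:
  assumes K: "finite K" "\<And>F. F \<in> K \<Longrightarrow> finite F \<and> F \<noteq> {}"
    and "{0} \<in> K"
    and face: "\<And>F. insert 0 F \<in> K \<Longrightarrow> 0 \<notin> F \<Longrightarrow> F \<noteq> {} \<Longrightarrow> F \<in> K"
  shows "1 - euler_char K = (\<Sum>J\<in>critical_faces K. (-1) ^ card J)"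
proof -
  let ?s = "\<lambda>F. (-1::int) ^ (card F - 1)"
  let ?L = "{L \<in> K. 0 \<notin> L \<and> insert 0 L \<in> K}"
  have K_eq: "K = insert {0} (critical_faces K \<union> (?L \<union> insert 0 ` ?L))"
  proof (intro equalityI subsetI)
    fix F assume F: "F \<in> K"
    show "F \<in> insert {0} (critical_faces K \<union> (?L \<union> insert 0 ` ?L))"
    proof (cases "0 \<in> F \<and> F \<noteq> {0}")
      case True
      then have "F = insert 0 (F - {0})" "F - {0} \<noteq> {}" by auto
      moreover from this have "F - {0} \<in> K" using face[of "F - {0}"] F by auto
      ultimately have "F - {0} \<in> ?L" using F by auto
      then show ?thesis using \<open>F = insert 0 (F - {0})\<close> by blast
    next
      case False
      then show ?thesis using F by (auto simp: critical_faces_def)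
    qed
  qed (use \<open>{0} \<in> K\<close> in \<open>auto simp: critical_faces_def\<close>)
  have fin: "finite (critical_faces K)" "finite ?L"
    using K(1) by (auto simp: critical_faces_def)
  have inj: "inj_on (insert 0) ?L"
    by (rule inj_onI) (metis (no_types, lifting) insert_ident mem_Collect_eq)
  have ne: "critical_faces K \<inter> (?L \<union> insert 0 ` ?L) = {}" "?L \<inter> insert 0 ` ?L = {}"
    "{0} \<notin> critical_faces K \<union> (?L \<union> insert 0 ` ?L)"
    using K(2) by (auto simp: critical_faces_def)
  have "euler_char K = (\<Sum>F\<in>K. ?s F)"
    using K by (rule euler_char_eq_sum)
  also have "\<dots> = (\<Sum>F\<in>insert {0} (critical_faces K \<union> (?L \<union> insert 0 ` ?L)). ?s F)"
    using K_eq by simp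
  also have "\<dots> = 1 + ((\<Sum>F\<in>critical_faces K. ?s F) + ((\<Sum>F\<in>?L. ?s F) + (\<Sum>F\<in>?L. ?s (insert 0 F))))"
    using ne fin by (simp add: sum.union_disjoint sum.reindex[OF inj])
  also have "(\<Sum>F\<in>?L. ?s (insert 0 F)) = - (\<Sum>F\<in>?L. ?s F)"
    unfolding sum_negf[symmetric]
  proof (intro sum.cong refl)
    fix F assume F: "F \<in> ?L"
    then obtain n where "card F = Suc n"
      using K(2)[of F] by (cases "card F") auto
    then show "?s (insert 0 F) = - ?s F" using F K(2)[of F] by simp
  qed
  also have "(\<Sum>F\<in>critical_faces K. ?s F) = - (\<Sum>F\<in>critical_faces K. (-1) ^ card F)"
    unfolding sum_negf[symmetric]
  proof (intro sum.cong refl)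
    fix F assume F: "F \<in> critical_faces K"
    then obtain n where "card F = Suc n"
      using K(2)[of F] by (cases "card F") (auto simp: critical_faces_def)
    then show "?s F = - ((-1) ^ card F)" by simp
  qed
  finally show ?thesis by simp
qed

section \<open>Fourier inversion and convolution of densities\<close>

text \<open>Fubini for the bounded kernel \<open>iexp (t * x)\<close>, which is symmetric in its
  variables. With a Gaussian as \<open>B\<close>, an integral of an unknown transform becomes one of
  the explicit Gaussian transform.\<close>

lemma integral_char_commute:
  assumes "real_distribution A" "real_distribution B"
  shows "(CLINT t|B. char A t) = (CLINT x|A. char B x)"
proof -
  interpret A: real_distribution A by fact
  interpret B: real_distribution B by fact
  interpret P: pair_prob_space A B ..
  have int: "integrable (A \<Otimes>\<^sub>M B) (\<lambda>(x, t). iexp (t * x))"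
    by (rule P.integrable_const_bound[where B=1]) auto
  have "(CLINT t|B. char A t) = (CLINT t|B. CLINT x|A. iexp (t * x))"
    by (simp add: char_def)
  also have "\<dots> = (CLINT x|A. CLINT t|B. iexp (t * x))"
    using P.Fubini_integral[OF int] by simp
  also have "\<dots> = (CLINT x|A. char B x)"
    by (simp add: char_def mult.commute)
  finally show ?thesis .
qed

text \<open>Symmetrization: the difference of two independent copies has the transform times its
  conjugate, so the squared modulus is itself a characteristic function. The scale \<open>s\<close>
  later becomes the width of a Gaussian.\<close>

lemma (in real_distribution) char_distr_diff:
  "char (distr (M \<Otimes>\<^sub>M M) borel (\<lambda>(x, y). s * (x - y))) t = complex_of_real ((cmod (char M (s * t)))\<^sup>2)"
proof -
  interpret P: pair_prob_space M M ..
  have int: "integrable (M \<Otimes>\<^sub>M M) (\<lambda>(x, y). iexp (s * t * x) * cnj (iexp (s * t * y)))"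
  proof -
    have "integrable (M \<Otimes>\<^sub>M M) (\<lambda>(x, y). iexp (s * t * x) * iexp (- (s * t * y)))"
      by (intro P.integrable_const_bound[where B=1]) (auto simp: norm_mult)
    moreover have "iexp (- u) = cnj (iexp u)" for u by (simp add: exp_cnj)
    ultimately show ?thesis by (simp only:)
  qed
  have "char (distr (M \<Otimes>\<^sub>M M) borel (\<lambda>(x, y). s * (x - y))) t =
      (CLINT p|M \<Otimes>\<^sub>M M. iexp (t * (case p of (x, y) \<Rightarrow> s * (x - y))))"
    unfolding char_def by (rule integral_distr) auto
  also have "\<dots> = (CLINT p|M \<Otimes>\<^sub>M M. (case p of (x, y) \<Rightarrow> iexp (s * t * x) * cnj (iexp (s * t * y))))"
    by (intro Bochner_Integration.integral_cong refl)
      (auto simp: exp_cnj exp_add[symmetric] algebra_simps)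
  also have "\<dots> = (CLINT x|M. CLINT y|M. iexp (s * t * x) * cnj (iexp (s * t * y)))"
    using P.integral_fst'[OF int] by simp
  also have "\<dots> = (CLINT x|M. iexp (s * t * x)) * cnj (CLINT y|M. iexp (s * t * y))"
    by simp
  also have "\<dots> = complex_of_real ((cmod (char M (s * t)))\<^sup>2)"
    unfolding char_def[symmetric] by (rule complex_norm_square[symmetric])
  finally show ?thesis .
qed

lemma integral_gaussian:
  fixes s x :: real
  assumes "s > 0"
  shows "integrable lborel (\<lambda>y. exp (- (s * (x - y))\<^sup>2 / 2))"
    and "(\<integral>y. exp (- (s * (x - y))\<^sup>2 / 2) \<partial>lborel) = sqrt (2 * pi) / s"
proof -
  have eq: "exp (- (s * (x - y))\<^sup>2 / 2) = sqrt (2 * pi) / s * normal_density x (1 / s) y" for y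
  proof -
    have "- (s * (x - y))\<^sup>2 / 2 = - (y - x)\<^sup>2 / (2 * (1 / s)\<^sup>2)"
      using power2_commute[of x y] by (simp add: power_mult_distrib power_divide)
    then show ?thesis
      using assms by (simp add: normal_density_def power_divide real_sqrt_divide)
  qed
  show "integrable lborel (\<lambda>y. exp (- (s * (x - y))\<^sup>2 / 2))"
    unfolding eq using assms by (intro integrable_mult_right integrable_normal_density) auto
  show "(\<integral>y. exp (- (s * (x - y))\<^sup>2 / 2) \<partial>lborel) = sqrt (2 * pi) / s"
    unfolding eq using assms by simp
qed

text \<open>A Parseval inequality: integrating the squared transform against Gaussians of growing
  width gives a bound that does not depend on the width.\<close>

lemma integrable_char_square:
  fixes f :: "real \<Rightarrow> real"
  assumes rd: "real_distribution (density lborel (\<lambda>x. ennreal (f x)))"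
    and [measurable]: "f \<in> borel_measurable borel"
    and f: "\<And>x. 0 \<le> f x" "\<And>x. f x \<le> C"
  shows "integrable lborel (\<lambda>t. (cmod (char (density lborel f) t))\<^sup>2)"
proof -
  let ?M = "density lborel (\<lambda>x. ennreal (f x))"
  interpret real_distribution ?M by fact
  interpret P: pair_prob_space ?M ?M ..
  interpret N: real_distribution std_normal_distribution by (rule real_dist_normal_dist)
  let ?\<phi> = "\<lambda>t. (cmod (char ?M t))\<^sup>2"
  have \<phi>_le: "?\<phi> t \<le> 1" for t
    using cmod_char_le_1[of t] by (simp add: power_le_one)
  have C: "0 \<le> C" using f order_trans by blast
  \<comment> \<open>The width cancels: the substitution contributes \<open>s\<close>, the
    normalization of the Gaussian \<open>sqrt (2 * pi)\<close>, and the Gaussian integral against a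
    density bounded by \<open>C\<close> at most \<open>C * sqrt (2 * pi) / s\<close>.\<close>
  have bound: "(\<integral>\<^sup>+t. ennreal (?\<phi> t * exp (- (t / s)\<^sup>2 / 2)) \<partial>lborel) \<le> ennreal (2 * pi * C)"
    if s: "s > 0" for s :: real
  proof -
    let ?D = "distr (?M \<Otimes>\<^sub>M ?M) borel (\<lambda>(x, y). s * (x - y))"
    have D: "real_distribution ?D"
      by (rule P.real_distribution_distr) simp
    have intN: "integrable lborel (\<lambda>t. std_normal_density t * ?\<phi> (s * t))"
    proof (rule Bochner_Integration.integrable_bound)
      show "integrable lborel std_normal_density" by simp
      show "AE t in lborel. norm (std_normal_density t * ?\<phi> (s * t)) \<le> norm (std_normal_density t)"
        using \<phi>_le by (auto simp: abs_mult normal_density_nonneg intro!: mult_left_le)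
    qed measurable
    have int2: "integrable (?M \<Otimes>\<^sub>M ?M) (\<lambda>(x, y). exp (- (s * (x - y))\<^sup>2 / 2))"
      by (rule P.integrable_const_bound[where B=1]) auto
    have inner: "(\<integral>y. exp (- (s * (x - y))\<^sup>2 / 2) \<partial>?M) \<le> C * (sqrt (2 * pi) / s)" for x
    proof -
      have "(\<integral>y. exp (- (s * (x - y))\<^sup>2 / 2) \<partial>?M) = (\<integral>y. f y * exp (- (s * (x - y))\<^sup>2 / 2) \<partial>lborel)"
        using f by (subst integral_density) auto
      also have "\<dots> \<le> (\<integral>y. C * exp (- (s * (x - y))\<^sup>2 / 2) \<partial>lborel)"
      proof (rule integral_mono)
        show ci: "integrable lborel (\<lambda>y. C * exp (- (s * (x - y))\<^sup>2 / 2))"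
          using integral_gaussian[OF s] by simp
        show "integrable lborel (\<lambda>y. f y * exp (- (s * (x - y))\<^sup>2 / 2))"
          by (rule Bochner_Integration.integrable_bound[OF ci]) (use f C in \<open>auto simp: abs_mult\<close>)
      qed (use f in auto)
      also have "\<dots> = C * (sqrt (2 * pi) / s)"
        using integral_gaussian[OF s] by simp
      finally show ?thesis .
    qed
    have "complex_of_real (\<integral>t. std_normal_density t * ?\<phi> (s * t) \<partial>lborel) =
        (CLINT t|lborel. std_normal_density t *\<^sub>R complex_of_real (?\<phi> (s * t)))"
      unfolding integral_complex_of_real[symmetric] by (simp add: scaleR_conv_of_real)
    also have "\<dots> = (CLINT t|std_normal_distribution. complex_of_real (?\<phi> (s * t)))"
      by (subst integral_density) (auto simp: normal_density_nonneg)
    also have "\<dots> = (CLINT t|std_normal_distribution. char ?D t)"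
      unfolding char_distr_diff ..
    also have "\<dots> = (CLINT x|?D. char std_normal_distribution x)"
      by (rule integral_char_commute[OF D real_dist_normal_dist])
    also have "\<dots> = complex_of_real (\<integral>x. exp (- x\<^sup>2 / 2) \<partial>?D)"
      unfolding char_std_normal_distribution by (rule integral_complex_of_real)
    also have "(\<integral>x. exp (- x\<^sup>2 / 2) \<partial>?D) = (\<integral>p. (case p of (x, y) \<Rightarrow> exp (- (s * (x - y))\<^sup>2 / 2)) \<partial>(?M \<Otimes>\<^sub>M ?M))"
      by (subst integral_distr) (auto intro!: Bochner_Integration.integral_cong)
    also have "\<dots> = (\<integral>x. \<integral>y. exp (- (s * (x - y))\<^sup>2 / 2) \<partial>?M \<partial>?M)"
      using P.integral_fst'[OF int2] by simp
    finally have "(\<integral>t. std_normal_density t * ?\<phi> (s * t) \<partial>lborel) =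
        (\<integral>x. \<integral>y. exp (- (s * (x - y))\<^sup>2 / 2) \<partial>?M \<partial>?M)"
      by (simp only: of_real_eq_iff)
    also have "\<dots> \<le> (\<integral>x. C * (sqrt (2 * pi) / s) \<partial>?M)"
      using P.integrable_fst'[OF int2] inner by (intro integral_mono) auto
    also have "\<dots> = C * (sqrt (2 * pi) / s)"
      using prob_space by simp
    finally have le: "(\<integral>t. std_normal_density t * ?\<phi> (s * t) \<partial>lborel) \<le> C * (sqrt (2 * pi) / s)" .
    have "(\<integral>\<^sup>+t. ennreal (?\<phi> t * exp (- (t / s)\<^sup>2 / 2)) \<partial>lborel) =
        ennreal s * (\<integral>\<^sup>+t. ennreal (?\<phi> (s * t) * exp (- t\<^sup>2 / 2)) \<partial>lborel)"
      using s by (subst nn_integral_real_affine[where c=s and t=0]) auto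
    also have "(\<integral>\<^sup>+t. ennreal (?\<phi> (s * t) * exp (- t\<^sup>2 / 2)) \<partial>lborel) =
        (\<integral>\<^sup>+t. ennreal (sqrt (2 * pi)) * ennreal (std_normal_density t * ?\<phi> (s * t)) \<partial>lborel)"
      by (intro nn_integral_cong) (simp add: ennreal_mult'[symmetric] std_normal_density_def field_simps)
    also have "\<dots> = ennreal (sqrt (2 * pi)) * ennreal (\<integral>t. std_normal_density t * ?\<phi> (s * t) \<partial>lborel)"
      using intN by (subst nn_integral_cmult) (auto simp: nn_integral_eq_integral normal_density_nonneg)
    also have "ennreal s * \<dots> \<le> ennreal s * (ennreal (sqrt (2 * pi)) * ennreal (C * (sqrt (2 * pi) / s)))"
      using le by (intro mult_left_mono ennreal_leI) auto
    also have "\<dots> = ennreal (2 * pi * C)"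
      using s C by (simp add: ennreal_mult'[symmetric])
    finally show ?thesis .
  qed
  \<comment> \<open>Fatou's lemma along the widths \<open>Suc n\<close>, for which the Gaussian
    factors tend to 1.\<close>
  have "(\<integral>\<^sup>+t. ennreal (?\<phi> t) \<partial>lborel) =
      (\<integral>\<^sup>+t. liminf (\<lambda>n. ennreal (?\<phi> t * exp (- (t / real (Suc n))\<^sup>2 / 2))) \<partial>lborel)"
  proof (intro nn_integral_cong)
    fix t
    have "(\<lambda>n. t / real (Suc n)) \<longlonglongrightarrow> 0"
      using LIMSEQ_Suc[OF lim_const_over_n[of t]] by simp
    then have "(\<lambda>n. ennreal (?\<phi> t * exp (- (t / real (Suc n))\<^sup>2 / 2))) \<longlonglongrightarrow> ennreal (?\<phi> t * exp (- 0\<^sup>2 / 2))"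
      by (intro tendsto_intros) auto
    then show "ennreal (?\<phi> t) = liminf (\<lambda>n. ennreal (?\<phi> t * exp (- (t / real (Suc n))\<^sup>2 / 2)))"
      using lim_imp_Liminf[OF trivial_limit_sequentially] by fastforce
  qed
  also have "\<dots> \<le> liminf (\<lambda>n. \<integral>\<^sup>+t. ennreal (?\<phi> t * exp (- (t / real (Suc n))\<^sup>2 / 2)) \<partial>lborel)"
    by (rule nn_integral_liminf) measurable
  also have "\<dots> \<le> ennreal (2 * pi * C)"
    using bound by (intro Liminf_le always_eventually allI) auto
  finally have "(\<integral>\<^sup>+t. ennreal (?\<phi> t) \<partial>lborel) < \<infinity>"
    using ennreal_less_top le_less_trans by (metis infinity_ennreal_def)
  then show ?thesis
    by (intro integrableI_bounded) auto
qed

text \<open>The kernel is bounded by \<open>b - a\<close> and by \<open>2 / \<bar>t\<bar>\<close>.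
  This does not make it integrable, but square integrable, as is the characteristic function;
  \<open>x * y \<le> x\<^sup>2 + y\<^sup>2\<close> then dominates the product.\<close>

lemma integrable_kernel_mult_char:
  fixes f :: "real \<Rightarrow> real"
  assumes rd: "real_distribution (density lborel (\<lambda>x. ennreal (f x)))"
    and [measurable]: "f \<in> borel_measurable borel"
    and f: "\<And>x. 0 \<le> f x" "\<And>x. f x \<le> C" and ab: "a \<le> b"
  shows "integrable lborel (\<lambda>t. (iexp (-(t * a)) - iexp (-(t * b))) / (\<i> * t) * char (density lborel f) t)"
proof -
  interpret real_distribution "density lborel (\<lambda>x. ennreal (f x))" by fact
  let ?k = "\<lambda>t::real. (iexp (-(t * a)) - iexp (-(t * b))) / (\<i> * t)"
  \<comment> \<open>The sum of the squares of the two bounds: one controls the squared kernel, the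
    other its product with the square of \<open>t\<close>.\<close>
  let ?c = "(b - a)\<^sup>2 + 4"
  have k: "(cmod (?k t))\<^sup>2 \<le> ?c * inverse (1 + t\<^sup>2)" for t
  proof (cases "t = 0")
    case False
    have 1: "cmod (?k t) \<le> b - a"
      using Levy_Inversion_aux2[of "-b" "-a" t] ab False by simp
    have "cmod (iexp (-(t * a)) - iexp (-(t * b))) \<le> cmod (iexp (-(t * a))) + cmod (iexp (-(t * b)))"
      by (rule norm_triangle_ineq4)
    also have "\<dots> = 2"
      unfolding norm_exp_i_times by simp
    finally have 2: "cmod (?k t) * \<bar>t\<bar> \<le> 2"
      using False by (simp add: norm_divide norm_mult)
    have "(cmod (?k t))\<^sup>2 * (1 + t\<^sup>2) = (cmod (?k t))\<^sup>2 + (cmod (?k t) * \<bar>t\<bar>)\<^sup>2"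
      by (simp add: distrib_left power_mult_distrib)
    also have "\<dots> \<le> (b - a)\<^sup>2 + 2\<^sup>2"
      using 1 2 by (intro add_mono power_mono) auto
    finally show ?thesis
      by (simp add: field_simps add_pos_nonneg)
  qed (simp add: add_nonneg_nonneg)
  have int: "integrable lborel (\<lambda>t. ?c * inverse (1 + t\<^sup>2) + (cmod (char (density lborel f) t))\<^sup>2)"
    using integrable_inverse_1_plus_square
    by (intro Bochner_Integration.integrable_add integrable_mult_right
        integrable_char_square[OF assms(1-4)]) (simp add: set_integrable_def)
  show ?thesis
  proof (rule Bochner_Integration.integrable_bound[OF int])
    show "AE t in lborel. norm (?k t * char (density lborel f) t)
      \<le> norm (?c * inverse (1 + t\<^sup>2) + (cmod (char (density lborel f) t))\<^sup>2)"
    proof (rule AE_I2)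
      fix t
      let ?x = "cmod (?k t)" and ?y = "cmod (char (density lborel f) t)"
      have "0 \<le> ?x" "0 \<le> ?y" by simp_all
      then have "?x * ?y \<le> ?x\<^sup>2 + ?y\<^sup>2"
        using sum_squares_bound[of ?x ?y] mult_nonneg_nonneg[of ?x ?y] by linarith
      also have "\<dots> \<le> ?c * inverse (1 + t\<^sup>2) + ?y\<^sup>2"
        using k[of t] by simp
      finally show "norm (?k t * char (density lborel f) t)
          \<le> norm (?c * inverse (1 + t\<^sup>2) + ?y\<^sup>2)"
        unfolding norm_mult[of "?k t"] real_norm_def by (rule order_trans[OF _ abs_ge_self])
    qed
  qed measurable
qed

text \<open>Levy's theorem yields only a limit of integrals over symmetric intervals. Integrability
  of the integrand and dominated convergence turn it into one Lebesgue integral; the endpoints carry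
  no mass because there is a density.\<close>

lemma Levy_inversion_density:
  fixes f :: "real \<Rightarrow> real"
  assumes rd: "real_distribution (density lborel (\<lambda>x. ennreal (f x)))"
    and [measurable]: "f \<in> borel_measurable borel"
    and f: "\<And>x. 0 \<le> f x" "\<And>x. f x \<le> C" and ab: "a \<le> b"
  shows "(CLINT t|lborel. (iexp (-(t * a)) - iexp (-(t * b))) / (\<i> * t) * char (density lborel f) t)
    = 2 * pi * measure (density lborel f) {a<..b}"
proof -
  interpret real_distribution "density lborel (\<lambda>x. ennreal (f x))" by fact
  let ?g = "\<lambda>t. (iexp (-(t * a)) - iexp (-(t * b))) / (\<i> * t) * char (density lborel f) t"
  have null: "measure (density lborel f) {x} = 0" for x
  proof -
    have "AE y in lborel. y \<noteq> x" by (rule AE_lborel_singleton)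
    then have "emeasure (density lborel f) {x} = 0"
      by (subst emeasure_density) (auto simp: nn_integral_0_iff_AE split: split_indicator)
    then show ?thesis by (simp add: measure_def)
  qed
  have int: "integrable lborel ?g"
    by (rule integrable_kernel_mult_char[OF assms])
  have "(\<lambda>n. CLINT t|lborel. indicator {- real n<..<real n} t *\<^sub>R ?g t) \<longlonglongrightarrow> (CLINT t|lborel. ?g t)"
  proof (rule integral_dominated_convergence)
    show "integrable lborel (\<lambda>t. cmod (?g t))" using int by (rule integrable_norm)
    show "AE t in lborel. (\<lambda>n. indicator {- real n<..<real n} t *\<^sub>R ?g t) \<longlonglongrightarrow> ?g t"
    proof (rule AE_I2)
      fix t :: real
      obtain n0 :: nat where "\<bar>t\<bar> < n0" using reals_Archimedean2 by blast
      then have "\<forall>\<^sub>F n in sequentially. indicator {- real n<..<real n} t *\<^sub>R ?g t = ?g t"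
      proof (intro eventually_sequentiallyI[of n0])
        fix n assume "n0 \<le> n"
        then have "t \<in> {- real n<..<real n}" using \<open>\<bar>t\<bar> < n0\<close> by auto
        then show "indicator {- real n<..<real n} t *\<^sub>R ?g t = ?g t"
          by (simp only: indicator_simps scaleR_one)
      qed
      then show "(\<lambda>n. indicator {- real n<..<real n} t *\<^sub>R ?g t) \<longlonglongrightarrow> ?g t"
        by (rule tendsto_eventually)
    qed
  qed (use int in \<open>auto split: split_indicator\<close>)
  moreover have "(CLBINT t=-n..n. ?g t) = (CLINT t|lborel. indicator {- real n<..<real n} t *\<^sub>R ?g t)" for n :: nat
    by (simp add: interval_lebesgue_integral_def set_lebesgue_integral_def)
  ultimately have "(\<lambda>n::nat. 1 / (2 * pi) * (CLBINT t=-n..n. ?g t)) \<longlonglongrightarrow> 1 / (2 * pi) * (CLINT t|lborel. ?g t)"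
    by (intro tendsto_mult tendsto_const) simp
  moreover have "(\<lambda>n::nat. 1 / (2 * pi) * (CLBINT t=-n..n. ?g t)) \<longlonglongrightarrow> complex_of_real (measure (density lborel f) {a<..b})"
    using Levy_Inversion[OF ab null null] .
  ultimately have "1 / (2 * pi) * (CLINT t|lborel. ?g t) = complex_of_real (measure (density lborel f) {a<..b})"
    by (rule LIMSEQ_unique)
  then show ?thesis by (simp add: field_simps)
qed

section \<open>Convolutions of continuous densities with compact support\<close>

lemma fun_conv_eq:
  fixes f g :: "real \<Rightarrow> real"
  shows "fun_conv f g q = (\<integral>y. f y * g (q - y) \<partial>lborel)"
  unfolding fun_conv_def
  by (subst lborel_integral_real_affine[where c="-1" and t=q]) auto

lemma integrable_bounded_mult:
  fixes f g :: "real \<Rightarrow> real"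
  assumes [measurable]: "f \<in> borel_measurable borel" and "\<And>x. \<bar>f x\<bar> \<le> C"
    and "integrable lborel g"
  shows "integrable lborel (\<lambda>x. f x * g x)"
proof (rule Bochner_Integration.integrable_bound)
  show "integrable lborel (\<lambda>x. C * g x)" using assms(3) by simp
  show "AE x in lborel. norm (f x * g x) \<le> norm (C * g x)"
    using mult_right_mono[OF order_trans[OF assms(2) abs_ge_self]]
    by (intro AE_I2) (simp add: abs_mult)
qed (use assms(3) in measurable)

text \<open>Dominated convergence with the bound \<open>C * \<bar>g x\<bar>\<close>. Continuity is
  asked of one factor, so that the other may be the indicator of \<open>[0, m]\<close>.\<close>

lemma continuous_fun_conv:
  fixes f g :: "real \<Rightarrow> real"
  assumes f: "continuous_on UNIV f" "\<And>x. \<bar>f x\<bar> \<le> C" and g: "integrable lborel g"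
  shows "continuous_on UNIV (fun_conv f g)"
proof (rule continuous_at_imp_continuous_on, rule ballI)
  fix a
  have [measurable]: "f \<in> borel_measurable borel"
    using f(1) by (rule borel_measurable_continuous_onI)
  show "isCont (fun_conv f g) a"
  proof (rule continuous_at_sequentiallyI)
    fix u assume u: "u \<longlonglongrightarrow> a"
    show "(\<lambda>n. fun_conv f g (u n)) \<longlonglongrightarrow> fun_conv f g a"
      unfolding fun_conv_def
    proof (rule integral_dominated_convergence)
      show "integrable lborel (\<lambda>x. C * \<bar>g x\<bar>)" using g by simp
      have "(\<lambda>n. f (u n - x)) \<longlonglongrightarrow> f (a - x)" for x
        using f(1) by (intro isCont_tendsto_compose[of _ f] tendsto_intros u)
          (auto simp: continuous_on_eq_continuous_at)
      then show "AE x in lborel. (\<lambda>n. f (u n - x) * g x) \<longlonglongrightarrow> f (a - x) * g x"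
        by (intro AE_I2 tendsto_mult tendsto_const)
      show "AE x in lborel. norm (f (u n - x) * g x) \<le> C * \<bar>g x\<bar>" for n
        using f(2) by (auto simp: abs_mult intro!: mult_right_mono)
    qed (use g in measurable)
  qed
qed

lemma fun_conv_eq_0:
  assumes "\<And>x. x \<notin> {a..b} \<Longrightarrow> f x = 0" "\<And>x. x \<notin> {c..d} \<Longrightarrow> g x = 0"
    and "q \<notin> {a + c..b + d}"
  shows "fun_conv f g q = 0"
proof -
  have "f (q - x) * g x = 0" for x
  proof (cases "x \<in> {c..d}")
    case True
    then have "q - x \<notin> {a..b}" using assms(3) by auto
    then show ?thesis using assms(1) by simp
  qed (use assms(2) in auto)
  then show ?thesis unfolding fun_conv_def by (simp only: integral_zero)
qed

lemma compact_fun_support: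
  assumes "\<And>x. x \<notin> {a..b} \<Longrightarrow> f x = 0"
  shows "compact (fun_support f)"
proof -
  have "fun_support f \<subseteq> {a..b}"
    unfolding fun_support_def
  proof (rule closure_minimal)
    show "{x. f x \<noteq> 0} \<subseteq> {a..b}" using assms by blast
  qed simp
  then show ?thesis
    using bounded_subset[OF bounded_closed_interval, of "fun_support f" a b]
    by (simp add: fun_support_def compact_eq_bounded_closed)
qed

text \<open>A class closed under convolution whose members are bounded and integrable. Vanishing off
  an interval is easier to carry through a convolution than compactness of a closure.\<close>

definition bump :: "(real \<Rightarrow> real) \<Rightarrow> bool" where
  "bump f \<longleftrightarrow> continuous_on UNIV f \<and> (\<forall>x. 0 \<le> f x) \<and> (\<exists>a b. \<forall>x. x \<notin> {a..b} \<longrightarrow> f x = 0)"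

lemma bumpI_fun_support:
  assumes "continuous_on UNIV f" "\<And>x. 0 \<le> f x" "compact (fun_support f)"
  shows "bump f"
proof -
  obtain a b where "fun_support f \<subseteq> {a..b}"
    using bounded_subset_cbox_symmetric[OF compact_imp_bounded[OF assms(3)]]
    unfolding cbox_interval by blast
  then have "x \<notin> {a..b} \<Longrightarrow> f x = 0" for x
    unfolding fun_support_def using closure_subset[of "{x. f x \<noteq> 0}"] by auto
  then show ?thesis using assms(1,2) unfolding bump_def by blast
qed

lemma bump_bounded:
  assumes "bump f"
  obtains C where "\<And>x. \<bar>f x\<bar> \<le> C"
proof -
  obtain a b where ab: "\<And>x. x \<notin> {a..b} \<Longrightarrow> f x = 0" and cont: "continuous_on UNIV f"
    using assms by (auto simp: bump_def)
  have "compact (f ` {a..b})"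
    using cont by (intro compact_continuous_image) (auto intro: continuous_on_subset)
  then obtain C where C: "\<And>x. x \<in> {a..b} \<Longrightarrow> \<bar>f x\<bar> \<le> C"
    using compact_imp_bounded bounded_iff by (metis imageI real_norm_def)
  have "\<bar>f x\<bar> \<le> max C 0" for x
    using C[of x] ab[of x] by (cases "x \<in> {a..b}") (auto simp: le_max_iff_disj)
  then show ?thesis by (rule that)
qed

lemma bump_integrable:
  assumes "bump f"
  shows "integrable lborel f"
proof -
  obtain a b where ab: "\<And>x. x \<notin> {a..b} \<Longrightarrow> f x = 0" and cont: "continuous_on UNIV f"
    using assms by (auto simp: bump_def)
  have "integrable lborel (\<lambda>x. indicator {a..b} x *\<^sub>R f x)"
    using cont by (intro borel_integrable_compact) (auto intro: continuous_on_subset)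
  also have "(\<lambda>x. indicator {a..b} x *\<^sub>R f x) = f"
    using ab by (auto simp: indicator_def fun_eq_iff)
  finally show ?thesis .
qed

lemma bump_fun_conv:
  assumes f: "bump f" and g: "bump g"
  shows "bump (fun_conv f g)"
proof -
  obtain C where "\<And>x. \<bar>f x\<bar> \<le> C" using f by (rule bump_bounded) blast
  then have "continuous_on UNIV (fun_conv f g)"
    using f bump_integrable[OF g] by (intro continuous_fun_conv) (auto simp: bump_def)
  moreover obtain a b c d where ab: "\<And>x. x \<notin> {a..b} \<Longrightarrow> f x = 0"
      and cd: "\<And>x. x \<notin> {c..d} \<Longrightarrow> g x = 0"
    using f g by (auto simp: bump_def)
  have "\<forall>q. q \<notin> {a + c..b + d} \<longrightarrow> fun_conv f g q = 0"
    using fun_conv_eq_0[of a b f c d g, OF ab cd] by blast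
  moreover have "0 \<le> fun_conv f g q" for q
    using f g by (auto simp: fun_conv_def bump_def intro!: integral_nonneg_AE)
  ultimately show ?thesis unfolding bump_def by blast
qed

lemma bump_conv_list: "l \<noteq> [] \<Longrightarrow> (\<And>g. g \<in> set l \<Longrightarrow> bump g) \<Longrightarrow> bump (conv_list l)"
  by (induction l rule: conv_list.induct) (auto intro!: bump_fun_conv)

text \<open>The first variable is independent of the sum of the others, so the density of the total
  is a convolution. The induction singles out lists of length one, where \<open>conv_list\<close> is
  the density itself; the remaining work is to pass from the nonnegative integral to the one in
  \<open>fun_conv\<close>.\<close>

lemma (in prob_space) distributed_sum_conv_list:
  fixes X :: "nat \<Rightarrow> 'a \<Rightarrow> real"
  assumes "l \<noteq> []" "distinct l" "indep_vars (\<lambda>_. borel) X (set l)"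
    and "\<And>i. i \<in> set l \<Longrightarrow> bump (f i)"
    and "\<And>i. i \<in> set l \<Longrightarrow> distributed M lborel (X i) (\<lambda>x. ennreal (f i x))"
  shows "distributed M lborel (\<lambda>\<omega>. \<Sum>i\<in>set l. X i \<omega>) (\<lambda>x. ennreal (conv_list (map f l) x))"
  using assms
proof (induction l rule: induct_list012)
  case (3 i k r)
  let ?F = "conv_list (map f (k # r))"
  have F: "bump ?F"
    using 3 by (intro bump_conv_list) auto
  have fi: "bump (f i)" using 3 by simp
  have cont: "continuous_on UNIV (f i)" "continuous_on UNIV ?F"
    using F fi by (auto simp: bump_def)
  have meas: "f i \<in> borel_measurable borel" "?F \<in> borel_measurable borel"
    using cont by (auto intro: borel_measurable_continuous_onI)
  have dist: "distributed M lborel (\<lambda>\<omega>. \<Sum>j\<in>set (k # r). X j \<omega>) (\<lambda>x. ennreal (?F x))"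
    using 3 by (intro "3.IH"(2)) (auto intro: indep_vars_subset)
  have indep: "indep_var borel (X i) borel (\<lambda>\<omega>. \<Sum>j\<in>set (k # r). X j \<omega>)"
    using 3 by (intro indep_vars_sum) auto
  have dist': "distributed M lborel (\<lambda>\<omega>. X i \<omega> + (\<Sum>j\<in>set (k # r). X j \<omega>))
      (\<lambda>x. \<integral>\<^sup>+y. ennreal (f i (x - y)) * ennreal (?F y) \<partial>lborel)"
    using 3 by (intro distributed_convolution[OF indep _ dist]) auto
  have sum: "(\<lambda>\<omega>. \<Sum>j\<in>set (i # k # r). X j \<omega>) = (\<lambda>\<omega>. X i \<omega> + (\<Sum>j\<in>set (k # r). X j \<omega>))"
    using 3 by (auto simp: fun_eq_iff)
  obtain C where C: "\<And>x. \<bar>f i x\<bar> \<le> C" using fi by (rule bump_bounded) blast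
  have "(\<integral>\<^sup>+y. ennreal (f i (x - y)) * ennreal (?F y) \<partial>lborel) =
      ennreal (conv_list (map f (i # k # r)) x)" for x
  proof -
    have "(\<integral>\<^sup>+y. ennreal (f i (x - y)) * ennreal (?F y) \<partial>lborel) =
        (\<integral>\<^sup>+y. ennreal (f i (x - y) * ?F y) \<partial>lborel)"
      using fi F by (intro nn_integral_cong) (auto simp: bump_def ennreal_mult')
    also have "\<dots> = ennreal (\<integral>y. f i (x - y) * ?F y \<partial>lborel)"
    proof (rule nn_integral_eq_integral)
      show "integrable lborel (\<lambda>y. f i (x - y) * ?F y)"
        by (rule integrable_bounded_mult[of _ C]) (use meas C bump_integrable[OF F] in auto)
    qed (use fi F in \<open>auto simp: bump_def\<close>)
    finally show ?thesis by (simp add: fun_conv_def)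
  qed
  then show ?case using dist' unfolding sum by simp
qed auto

lemma (in prob_space) distributed_sum_conv_family:
  fixes X :: "nat \<Rightarrow> 'a \<Rightarrow> real"
  assumes J: "finite J" "J \<noteq> {}" and "indep_vars (\<lambda>_. borel) X J"
    and "\<And>i. i \<in> J \<Longrightarrow> bump (f i)"
    and "\<And>i. i \<in> J \<Longrightarrow> distributed M lborel (X i) (\<lambda>x. ennreal (f i x))"
  shows "distributed M lborel (\<lambda>\<omega>. \<Sum>i\<in>J. X i \<omega>) (\<lambda>x. ennreal (conv_family f J x))"
    and "bump (conv_family f J)"
proof -
  have l: "set (sorted_list_of_set J) = J" "sorted_list_of_set J \<noteq> []" using J by auto
  show "distributed M lborel (\<lambda>\<omega>. \<Sum>i\<in>J. X i \<omega>) (\<lambda>x. ennreal (conv_family f J x))"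
    using distributed_sum_conv_list[of "sorted_list_of_set J" X f] l assms
    unfolding conv_family_def by simp
  show "bump (conv_family f J)"
    unfolding conv_family_def by (rule bump_conv_list) (use l assms in auto)
qed

text \<open>Convolving with the indicator integrates \<open>f\<close> over an interval of length
  \<open>m\<close> ending at \<open>q\<close>, and endpoints are null sets. The first form fits
  Levy's formula, the second the critical faces.\<close>

lemma fun_conv_indicator:
  assumes "bump f"
  shows "measure (density lborel (\<lambda>x. ennreal (f x))) {q - m<..q} = fun_conv f (indicator {0..m}) q"
    and "measure (density lborel (\<lambda>x. ennreal (f x))) {q - m..<q} = fun_conv f (indicator {0..m}) q"
proof -
  have f: "\<And>x. 0 \<le> f x" and [measurable]: "f \<in> borel_measurable borel"
    using assms by (auto simp: bump_def intro: borel_measurable_continuous_onI)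
  have "measure (density lborel (\<lambda>x. ennreal (f x))) A = fun_conv f (indicator {0..m}) q"
    if [measurable]: "A \<in> sets borel" and A: "A \<subseteq> {q - m..q}" "{q - m<..<q} \<subseteq> A" for A
  proof -
    have int: "integrable lborel (\<lambda>y. f y * indicator A y)"
      using integrable_mult_indicator[of A lborel f] bump_integrable[OF assms]
      by (simp add: mult.commute)
    have "emeasure (density lborel (\<lambda>x. ennreal (f x))) A = (\<integral>\<^sup>+y. ennreal (f y * indicator A y) \<partial>lborel)"
      by (subst emeasure_density) (auto intro!: nn_integral_cong split: split_indicator)
    also have "\<dots> = ennreal (\<integral>y. f y * indicator A y \<partial>lborel)"
      using int f by (intro nn_integral_eq_integral) auto
    finally have "measure (density lborel (\<lambda>x. ennreal (f x))) A = (\<integral>y. f y * indicator A y \<partial>lborel)"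
      using f by (simp add: measure_def)
    also have "\<dots> = (\<integral>y. f y * indicator {0..m} (q - y) \<partial>lborel)"
    proof (rule integral_cong_AE)
      show "AE y in lborel. f y * indicator A y = f y * indicator {0..m} (q - y)"
        using AE_lborel_singleton[of q] AE_lborel_singleton[of "q - m"]
      proof eventually_elim
        case (elim y)
        have "y \<in> A \<longleftrightarrow> q - y \<in> {0..m}"
        proof
          assume "q - y \<in> {0..m}"
          then have "y \<in> {q - m<..<q}" using elim by auto
          then show "y \<in> A" using A by auto
        qed (use A in force)
        then show ?case by (simp add: indicator_def)
      qed
    qed auto
    finally show ?thesis by (simp add: fun_conv_eq)
  qed
  note * = this
  show "measure (density lborel (\<lambda>x. ennreal (f x))) {q - m<..q} = fun_conv f (indicator {0..m}) q"
    by (rule *) auto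
  show "measure (density lborel (\<lambda>x. ennreal (f x))) {q - m..<q} = fun_conv f (indicator {0..m}) q"
    by (rule *) auto
qed

lemma
  assumes "bump f" and "0 \<le> m"
  shows continuous_fun_conv_indicator: "continuous_on UNIV (fun_conv f (indicator {0..m}))"
    and fun_conv_indicator_bounded_support:
      "\<exists>a b. \<forall>q. q \<notin> {a..b} \<longrightarrow> fun_conv f (indicator {0..m}) q = 0"
proof -
  obtain C where "\<And>x. \<bar>f x\<bar> \<le> C" using assms(1) by (rule bump_bounded) blast
  moreover have "integrable lborel (indicator {0..m} :: real \<Rightarrow> real)"
    using emeasure_lborel_Icc_eq[of 0 m] by (simp add: integrable_indicator_iff)
  ultimately show "continuous_on UNIV (fun_conv f (indicator {0..m}))"
    using assms by (intro continuous_fun_conv) (auto simp: bump_def)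
  obtain a b where "\<And>x. x \<notin> {a..b} \<Longrightarrow> f x = 0"
    using assms by (auto simp: bump_def)
  then have "\<forall>q. q \<notin> {a + 0..b + m} \<longrightarrow> fun_conv f (indicator {0..m}) q = 0"
    by (intro allI impI fun_conv_eq_0[of a b _ 0 m]) (auto simp: indicator_def)
  then show "\<exists>a b. \<forall>q. q \<notin> {a..b} \<longrightarrow> fun_conv f (indicator {0..m}) q = 0" by blast
qed

section \<open>Fourier transforms and inversion\<close>

lemma prod_one_minus:
  fixes f :: "'i \<Rightarrow> 'c::comm_ring_1"
  assumes "finite A"
  shows "(\<Prod>i\<in>A. 1 - f i) = (\<Sum>J\<in>Pow A. (-1) ^ card J * (\<Prod>i\<in>J. f i))"
  using prod_add[OF assms, of "\<lambda>i. - f i" "\<lambda>_. 1"] by (simp add: prod_uminus)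

text \<open>\<open>char\<close> integrates \<open>iexp (t * x)\<close>, so the frequency is scaled
  by \<open>2 * pi\<close> and its sign is reversed.\<close>

lemma fourier_eq_char:
  fixes f :: "real \<Rightarrow> real"
  assumes "distributed M lborel X (\<lambda>x. ennreal (f x))"
    and "\<And>x. 0 \<le> f x" and [measurable]: "f \<in> borel_measurable borel"
  shows "fourier f \<alpha> = char (distr M borel X) (- 2 * pi * \<alpha>)"
proof -
  have "distr M borel X = distr M lborel X" by (rule distr_cong) auto
  also have "\<dots> = density lborel (\<lambda>x. ennreal (f x))"
    using assms(1) by (rule distributed_distr_eq_density)
  finally have "char (distr M borel X) (- 2 * pi * \<alpha>) =
      (CLINT x|density lborel (\<lambda>x. ennreal (f x)). iexp (- 2 * pi * \<alpha> * x))"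
    by (simp add: char_def)
  also have "\<dots> = (CLINT x|lborel. f x *\<^sub>R iexp (- 2 * pi * \<alpha> * x))"
    using assms by (subst integral_density) auto
  also have "\<dots> = fourier f \<alpha>"
    unfolding fourier_def
    by (intro Bochner_Integration.integral_cong refl) (simp add: scaleR_conv_of_real algebra_simps)
  finally show ?thesis ..
qed

text \<open>Under \<open>t = - 2 * pi * \<alpha>\<close> the integrand is
  \<open>2 * pi * \<i>\<close> times Levy's integrand for the interval from \<open>q - m\<close> to
  \<open>q\<close>. The Jacobian cancels the \<open>2 * pi\<close> in Levy's formula, which leaves
  the constant that the prefactor of \<open>euler_integral\<close> removes.\<close>

lemma fourier_inversion_indicator:
  fixes f :: "real \<Rightarrow> real"
  assumes f: "bump f" and "prob_space (density lborel (\<lambda>x. ennreal (f x)))" and m: "0 \<le> m"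
  defines "K \<equiv> \<lambda>q \<alpha>. exp (2 * pi * \<i> * \<alpha> * q) * (1 - exp (- 2 * pi * \<i> * \<alpha> * m)) / \<alpha> *
    char (density lborel (\<lambda>x. ennreal (f x))) (- 2 * pi * \<alpha>)"
  shows "integrable lborel (K q)"
    and "(CLINT \<alpha>|lborel. K q \<alpha>) = 2 * pi * \<i> * fun_conv f (indicator {0..m}) q"
proof -
  have rd: "real_distribution (density lborel (\<lambda>x. ennreal (f x)))"
    using assms(2) by (simp add: real_distribution_def real_distribution_axioms_def)
  have meas: "f \<in> borel_measurable borel" and f0: "\<And>x. 0 \<le> f x"
    using f by (auto simp: bump_def intro: borel_measurable_continuous_onI)
  obtain C where C: "\<And>x. \<bar>f x\<bar> \<le> C" using f by (rule bump_bounded) blast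
  have fC: "f x \<le> C" for x using C[of x] by simp
  have qm: "q - m \<le> q" using m by simp
  let ?g = "\<lambda>t::real. (iexp (-(t * (q - m))) - iexp (-(t * q))) / (\<i> * t) *
    char (density lborel (\<lambda>x. ennreal (f x))) t"
  have K: "K q = (\<lambda>\<alpha>. 2 * pi * \<i> * ?g (0 + (- 2 * pi) * \<alpha>))"
  proof
    fix \<alpha> :: real
    have e1: "iexp (-((0 + (- 2 * pi) * \<alpha>) * q)) = exp (2 * pi * \<i> * \<alpha> * q)"
      by (rule arg_cong[where f=exp]) (simp add: algebra_simps)
    have e2: "iexp (-((0 + (- 2 * pi) * \<alpha>) * (q - m))) =
        exp (2 * pi * \<i> * \<alpha> * q) * exp (- 2 * pi * \<i> * \<alpha> * m)"
      unfolding exp_add[symmetric] by (rule arg_cong[where f=exp]) (simp add: algebra_simps)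
    \<comment> \<open>At \<open>\<alpha> = 0\<close> both quotients are 0 by the convention for
      division.\<close>
    show "K q \<alpha> = 2 * pi * \<i> * ?g (0 + (- 2 * pi) * \<alpha>)"
      unfolding e1 e2 K_def by (cases "\<alpha> = 0") (simp_all add: field_simps)
  qed
  have int: "integrable lborel ?g"
    using integrable_kernel_mult_char[OF rd meas f0 fC qm] .
  then have "integrable lborel (\<lambda>\<alpha>. ?g (0 + (- 2 * pi) * \<alpha>))"
    by (rule lborel_integrable_real_affine) simp
  then show "integrable lborel (K q)"
    unfolding K by (rule integrable_mult_right)
  have cancel: "z = complex_of_real c" if "(2 * pi) *\<^sub>R z = complex_of_real (2 * pi * c)" for z c
    using that by (simp add: scaleR_conv_of_real)
  have "(2 * pi) *\<^sub>R (CLINT \<alpha>|lborel. ?g (0 + (- 2 * pi) * \<alpha>)) = (CLINT t|lborel. ?g t)"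
    by (subst (2) lborel_integral_real_affine[where c="- 2 * pi" and t=0]) auto
  also have "\<dots> = complex_of_real (2 * pi * fun_conv f (indicator {0..m}) q)"
    using Levy_inversion_density[OF rd meas f0 fC qm] fun_conv_indicator(1)[OF f] by simp
  finally have "(CLINT \<alpha>|lborel. ?g (0 + (- 2 * pi) * \<alpha>)) = fun_conv f (indicator {0..m}) q"
    by (rule cancel)
  then show "(CLINT \<alpha>|lborel. K q \<alpha>) = 2 * pi * \<i> * fun_conv f (indicator {0..m}) q"
    unfolding K by (simp only: integral_mult_right_zero)
qed

section \<open>Quota complexes\<close>

lemma finite_quota_complex: "finite (quota_complex N w q)"
  by (rule finite_subset[of _ "Pow {0..N}"]) (auto simp: quota_complex_def)

lemma critical_faces_quota_complex:
  assumes "w 0 = m"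
  shows "critical_faces (quota_complex N w q) = {J \<in> Pow {1..N} - {{}}. sum w J \<in> {q - m..<q}}"
proof -
  have eq: "J \<subseteq> {0..N} \<and> 0 \<notin> J \<longleftrightarrow> J \<subseteq> {1..N}" for J :: "nat set"
    by (force simp: Suc_le_eq intro: gr0I)
  have "finite J" if "J \<subseteq> {1..N}" for J :: "nat set" using that finite_subset by blast
  then have ins: "sum w (insert 0 J) = m + sum w J" if "J \<subseteq> {1..N}" for J
    using that assms by (subst sum.insert) auto
  show ?thesis
  proof (intro equalityI subsetI)
    fix J assume "J \<in> critical_faces (quota_complex N w q)"
    then have J: "J \<noteq> {}" "J \<subseteq> {1..N}" "sum w J < q" "insert 0 J \<notin> quota_complex N w q"
      using eq[of J] by (auto simp: critical_faces_def quota_complex_def)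
    moreover have "insert 0 J \<subseteq> {0..N}" using J(2) by auto
    ultimately show "J \<in> {J \<in> Pow {1..N} - {{}}. sum w J \<in> {q - m..<q}}"
      using ins[OF J(2)] by (auto simp: quota_complex_def)
  next
    fix J assume "J \<in> {J \<in> Pow {1..N} - {{}}. sum w J \<in> {q - m..<q}}"
    then show "J \<in> critical_faces (quota_complex N w q)"
      using eq[of J] ins[of J] by (auto simp: critical_faces_def quota_complex_def)
  qed
qed

lemma dim_reduced_homology_quota_complex:
  assumes w: "w 0 = m" "\<And>i. i \<in> {1..N} \<Longrightarrow> m \<le> w i"
  shows "dim_reduced_homology (quota_complex N w q) p =
    card {J \<in> {J. J \<subseteq> {1..N} \<and> card J = Suc p}. sum w J \<in> {q - m..<q}}"
proof -
  have "dim_reduced_homology (quota_complex N w q) p =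
      card {J \<in> critical_faces (quota_complex N w q). card J = Suc p}"
  proof (rule dim_reduced_homology_eq_card_critical[where U="{0..N}"])
    fix F v assume "F \<in> quota_complex N w q" and F0: "0 \<notin> F" and v: "v \<in> F"
    then have F: "F \<subseteq> {0..N}" "sum w F < q" by (auto simp: quota_complex_def)
    have "finite F" using F(1) finite_subset by blast
    have "v \<noteq> 0" using v F0 by metis
    then have "m \<le> w v" using F(1) v w(2)[of v] by auto
    moreover have "sum w F = w v + sum w (F - {v})"
      using \<open>finite F\<close> v by (rule sum.remove)
    moreover have "sum w (insert 0 (F - {v})) = m + sum w (F - {v})"
      using \<open>finite F\<close> F0 w(1) by simp
    ultimately show "insert 0 (F - {v}) \<in> quota_complex N w q"
      using F by (auto simp: quota_complex_def)
  qed (auto simp: quota_complex_def)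
  also have "{J \<in> critical_faces (quota_complex N w q). card J = Suc p} =
      {J \<in> {J. J \<subseteq> {1..N} \<and> card J = Suc p}. sum w J \<in> {q - m..<q}}"
    unfolding critical_faces_quota_complex[of w, OF w(1)] by auto
  finally show ?thesis .
qed

text \<open>\<open>{0}\<close> is a face because \<open>m < q\<close>, and removing 0 from a larger
  face leaves a face because \<open>m\<close> is positive.\<close>

lemma euler_char_quota_complex:
  assumes w: "w 0 = m" and "0 < m" "m < q"
  shows "1 - euler_char (quota_complex N w q) =
    (\<Sum>J\<in>Pow {1..N} - {{}}. if sum w J \<in> {q - m..<q} then (-1) ^ card J else 0)"
proof -
  have fin: "finite F" if "F \<subseteq> {0..N}" for F :: "nat set" using that finite_subset by blast
  have "1 - euler_char (quota_complex N w q) =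
      (\<Sum>J\<in>critical_faces (quota_complex N w q). (-1) ^ card J)"
  proof (rule euler_char_eq_sum_critical[OF finite_quota_complex])
    fix F assume "F \<in> quota_complex N w q"
    then show "finite F \<and> F \<noteq> {}" using fin by (auto simp: quota_complex_def)
  next
    show "{0} \<in> quota_complex N w q" using assms by (simp add: quota_complex_def)
  next
    fix F assume "insert 0 F \<in> quota_complex N w q" "0 \<notin> F" "F \<noteq> {}"
    then show "F \<in> quota_complex N w q"
      using fin[of F] assms by (simp add: quota_complex_def)
  qed
  also have "\<dots> = (\<Sum>J\<in>Pow {1..N} - {{}}. if sum w J \<in> {q - m..<q} then (-1) ^ card J else 0)"
    unfolding critical_faces_quota_complex[of w, OF w] by (rule sum.inter_filter) simp
  finally show ?thesis .
qed

text \<open>The complex takes finitely many values, and each is singled out by finitely many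
  inequalities between sums of the variables. Hence any function of it is measurable, even one given
  by a definite description.\<close>

lemma measurable_quota_complex:
  fixes X :: "nat \<Rightarrow> 'a \<Rightarrow> real" and h :: "nat set set \<Rightarrow> real"
  assumes X: "\<And>i. i \<le> N \<Longrightarrow> X i \<in> borel_measurable M"
  shows "(\<lambda>\<omega>. h (quota_complex N (\<lambda>i. X i \<omega>) q)) \<in> borel_measurable M"
proof (rule measurable_compose[where N="count_space (Pow (Pow {0..N}))"])
  have "(\<lambda>\<omega>. quota_complex N (\<lambda>i. X i \<omega>) q) -` {K} \<inter> space M \<in> sets M" if K: "K \<subseteq> Pow {0..N}" for K
  proof -
    have "quota_complex N w q = K \<longleftrightarrow> (\<forall>F\<in>Pow {0..N}. (F \<noteq> {} \<and> sum w F < q) = (F \<in> K))" for w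
      unfolding quota_complex_def set_eq_iff mem_Collect_eq
      using K by (intro iff_allI all_cong iffI) blast+
    then have "(\<lambda>\<omega>. quota_complex N (\<lambda>i. X i \<omega>) q) -` {K} \<inter> space M =
        {\<omega> \<in> space M. \<forall>F\<in>Pow {0..N}. (F \<noteq> {} \<and> (\<Sum>i\<in>F. X i \<omega>) < q) = (F \<in> K)}"
      by blast
    also have "\<dots> \<in> sets M"
    proof (rule sets.sets_Collect_finite_All)
      fix F assume F: "F \<in> Pow {0..N}"
      have [measurable]: "(\<lambda>\<omega>. \<Sum>i\<in>F. X i \<omega>) \<in> borel_measurable M"
        using F by (intro borel_measurable_sum X) auto
      show "{\<omega> \<in> space M. (F \<noteq> {} \<and> (\<Sum>i\<in>F. X i \<omega>) < q) = (F \<in> K)} \<in> sets M"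
        by measurable
    qed simp
    finally show ?thesis .
  qed
  then show "(\<lambda>\<omega>. quota_complex N (\<lambda>i. X i \<omega>) q) \<in> measurable M (count_space (Pow (Pow {0..N})))"
    by (subst measurable_count_space_eq2) (auto simp: quota_complex_def)
qed simp

theorem theorem1p8:
  fixes M :: "'a measure" and X :: "nat \<Rightarrow> 'a \<Rightarrow> real" and f :: "nat \<Rightarrow> real \<Rightarrow> real"
    and m :: real and N :: nat
  assumes "prob_space M"
    and "m > 0"
    and "\<forall>\<omega>\<in>space M. X 0 \<omega> = m"
    and "prob_space.indep_vars M (\<lambda>_. borel) X {1..N}"
    and "\<forall>i\<in>{1..N}. distributed M lborel (X i) (\<lambda>x. ennreal (f i x))"
    and "\<forall>i\<in>{1..N}. \<forall>x. f i x \<ge> 0"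
    and "\<forall>i\<in>{1..N}. continuous_on UNIV (f i)"
    and "\<forall>i\<in>{1..N}. compact (fun_support (f i)) \<and> fun_support (f i) \<subseteq> {m..}"
  defines "\<X> \<equiv> \<lambda>q \<omega>. quota_complex N (\<lambda>i. X i \<omega>) q"
    and "B \<equiv> \<lambda>j q. \<Sum>J\<in>{J. J \<subseteq> {1..N} \<and> card J = j}. fun_conv (conv_family f J) (indicator {0..m}) q"
  shows "(\<forall>j\<ge>1.
            (\<forall>q>m. integrable M (\<lambda>\<omega>. real (dim_reduced_homology (\<X> q \<omega>) (j - 1))) \<and>
                    (\<integral>\<omega>. real (dim_reduced_homology (\<X> q \<omega>) (j - 1)) \<partial>M) = B j q) \<and>
            continuous_on UNIV (B j) \<and> compact (fun_support (B j))) \<and>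
         (\<forall>q>m. integrable M (\<lambda>\<omega>. real_of_int (euler_char (\<X> q \<omega>))) \<and>
                 complex_of_real (1 - (\<integral>\<omega>. real_of_int (euler_char (\<X> q \<omega>)) \<partial>M)) =
                   euler_integral N m f q) \<and>
         (\<forall>q. integrable lborel (euler_integrand N m f q)) \<and>
         continuous_on UNIV (euler_integral N m f) \<and> compact (fun_support (euler_integral N m f))"
proof -
  interpret prob_space M by fact
  let ?I = "indicator {0..m} :: real \<Rightarrow> real"
  let ?A = "\<lambda>q. {q - m..<q}"
  define G where "G J q = fun_conv (conv_family f J) ?I q" for J q
  define \<J> where "\<J> = Pow {1..N} - {{}}"
  have fin_\<J>: "finite \<J>" by (simp add: \<J>_def)
  have \<J>: "finite J" "J \<noteq> {}" "J \<subseteq> {1..N}" if "J \<in> \<J>" for J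
    using that finite_subset[of J "{1..N}"] by (auto simp: \<J>_def)
  have m: "0 \<le> m" using \<open>m > 0\<close> by simp
  have bump: "bump (f i)" if "i \<in> {1..N}" for i
    using assms that by (intro bumpI_fun_support) auto
  have meas_f: "f i \<in> borel_measurable borel" if "i \<in> {1..N}" for i
    using bump[OF that] by (auto simp: bump_def intro: borel_measurable_continuous_onI)
  have X0: "X 0 \<omega> = m" if "\<omega> \<in> space M" for \<omega>
    using assms that by simp
  have X[measurable]: "X i \<in> borel_measurable M" if "i \<le> N" for i
  proof (cases "i = 0")
    case True
    have "(\<lambda>_. m) \<in> borel_measurable M" by simp
    then show ?thesis using X0 True by (subst measurable_cong) auto
  next
    case False
    then have "distributed M lborel (X i) (\<lambda>x. ennreal (f i x))" using assms that by simp
    then show ?thesis using distributed_measurable by fastforce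
  qed
  have S[measurable]: "(\<lambda>\<omega>. \<Sum>i\<in>J. X i \<omega>) \<in> borel_measurable M" if "J \<in> \<J>" for J
    using \<J>(3)[OF that] by (intro borel_measurable_sum X) auto

  \<comment> \<open>Laws of the subset sums\<close>
  have indep: "indep_vars (\<lambda>_. borel) X J" if "J \<in> \<J>" for J
    using assms \<J>(3)[OF that] by (auto intro: indep_vars_subset)
  have dist: "distributed M lborel (\<lambda>\<omega>. \<Sum>i\<in>J. X i \<omega>) (\<lambda>x. ennreal (conv_family f J x))"
    and bump_J: "bump (conv_family f J)" if J: "J \<in> \<J>" for J
  proof -
    have "bump (f i)" "distributed M lborel (X i) (\<lambda>x. ennreal (f i x))" if "i \<in> J" for i
      using that \<J>(3)[OF J] bump assms by auto
    then show "distributed M lborel (\<lambda>\<omega>. \<Sum>i\<in>J. X i \<omega>) (\<lambda>x. ennreal (conv_family f J x))"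
      "bump (conv_family f J)"
      using distributed_sum_conv_family[OF \<J>(1,2)[OF J] indep[OF J]] by blast+
  qed
  have distr_S: "distr M borel (\<lambda>\<omega>. \<Sum>i\<in>J. X i \<omega>) = density lborel (\<lambda>x. ennreal (conv_family f J x))"
    if "J \<in> \<J>" for J
  proof -
    have "distr M borel (\<lambda>\<omega>. \<Sum>i\<in>J. X i \<omega>) = distr M lborel (\<lambda>\<omega>. \<Sum>i\<in>J. X i \<omega>)"
      by (rule distr_cong) auto
    then show ?thesis using distributed_distr_eq_density[OF dist[OF that]] by simp
  qed
  have G_eq: "integrable M (\<lambda>\<omega>. indicat_real (?A q) (\<Sum>i\<in>J. X i \<omega>) :: real)"
    "(\<integral>\<omega>. indicat_real (?A q) (\<Sum>i\<in>J. X i \<omega>) \<partial>M) = G J q" if J: "J \<in> \<J>" for J q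
  proof -
    note [measurable] = S[OF J]
    show "integrable M (\<lambda>\<omega>. indicat_real (?A q) (\<Sum>i\<in>J. X i \<omega>) :: real)"
      by (rule integrable_const_bound[where B=1]) (auto simp: indicator_def)
    have "(\<integral>\<omega>. indicat_real (?A q) (\<Sum>i\<in>J. X i \<omega>) \<partial>M) =
        (\<integral>x. indicat_real (?A q) x \<partial>distr M borel (\<lambda>\<omega>. \<Sum>i\<in>J. X i \<omega>))"
      by (subst integral_distr) auto
    also have "\<dots> = measure (density lborel (\<lambda>x. ennreal (conv_family f J x))) (?A q)"
      unfolding distr_S[OF J] by simp
    also have "\<dots> = G J q"
      unfolding G_def by (rule fun_conv_indicator(2)[OF bump_J[OF J]])
    finally show "(\<integral>\<omega>. indicat_real (?A q) (\<Sum>i\<in>J. X i \<omega>) \<partial>M) = G J q" .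
  qed
  have cont_G: "continuous_on UNIV (G J)" if "J \<in> \<J>" for J
    using continuous_fun_conv_indicator[OF bump_J[OF that] m] by (simp add: G_def[abs_def])
  have "\<exists>R. \<forall>J\<in>\<J>. \<forall>q. q \<notin> {-R..R} \<longrightarrow> G J q = 0"
  proof -
    have "\<forall>J\<in>\<J>. \<exists>a b. \<forall>q. q \<notin> {a..b} \<longrightarrow> G J q = 0"
      using fun_conv_indicator_bounded_support[OF bump_J m] unfolding G_def by blast
    then obtain a b where ab: "\<And>J q. J \<in> \<J> \<Longrightarrow> q \<notin> {a J..b J} \<Longrightarrow> G J q = 0"
      by metis
    \<comment> \<open>Adding up all \<open>\<bar>a J\<bar> + \<bar>b J\<bar>\<close> gives one
      radius that covers the finitely many intervals.\<close>
    have "G J q = 0" if J: "J \<in> \<J>" and q: "q \<notin> {-(\<Sum>J\<in>\<J>. \<bar>a J\<bar> + \<bar>b J\<bar>)..(\<Sum>J\<in>\<J>. \<bar>a J\<bar> + \<bar>b J\<bar>)}" for J q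
    proof (rule ab[OF J])
      have "\<bar>a J\<bar> + \<bar>b J\<bar> \<le> (\<Sum>J\<in>\<J>. \<bar>a J\<bar> + \<bar>b J\<bar>)"
        using fin_\<J> J by (intro member_le_sum) auto
      then show "q \<notin> {a J..b J}" using q by auto
    qed
    then show ?thesis by blast
  qed
  then obtain R where R: "\<And>J q. J \<in> \<J> \<Longrightarrow> q \<notin> {-R..R} \<Longrightarrow> G J q = 0" by blast

  have B: "B j = (\<lambda>q. \<Sum>J\<in>{J. J \<subseteq> {1..N} \<and> card J = j}. G J q)" for j
    unfolding assms G_def by auto
  have sub: "J \<in> \<J>" if "J \<in> {J. J \<subseteq> {1..N} \<and> card J = j}" "1 \<le> j" for J j
    using that by (auto simp: \<J>_def)

  \<comment> \<open>Expected dimension of the homology\<close>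
  have "AE \<omega> in M. \<forall>i\<in>{1..N}. m \<le> X i \<omega>"
  proof (rule AE_finite_allI)
    fix i assume i: "i \<in> {1..N}"
    then have D: "distributed M lborel (X i) (\<lambda>x. ennreal (f i x))" using assms by simp
    have "f i x = 0" if "x < m" for x
      using assms i that closure_subset[of "{x. f i x \<noteq> 0}"] unfolding fun_support_def by force
    then have "AE x in lborel. 0 < ennreal (f i x) \<longrightarrow> m \<le> x"
      by (intro AE_I2) (metis ennreal_0 less_irrefl not_le)
    then show "AE \<omega> in M. m \<le> X i \<omega>"
      using distributed_AE2[OF D, of "\<lambda>x. m \<le> x"] by simp
  qed simp
  \<comment> \<open>The support condition bounds the weights below only outside a null set, so the
    exchange of vertices, and with it the count, is an almost sure statement.\<close>
  then have dim_AE: "AE \<omega> in M. \<forall>q p. real (dim_reduced_homology (\<X> q \<omega>) p) =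
      (\<Sum>J\<in>{J. J \<subseteq> {1..N} \<and> card J = Suc p}. indicat_real (?A q) (\<Sum>i\<in>J. X i \<omega>))"
    using AE_space
  proof eventually_elim
    case (elim \<omega>)
    show ?case
    proof (intro allI)
      fix q p
      have "dim_reduced_homology (\<X> q \<omega>) p =
          card {J \<in> {J. J \<subseteq> {1..N} \<and> card J = Suc p}. (\<Sum>i\<in>J. X i \<omega>) \<in> ?A q}"
        unfolding assms using elim X0 by (intro dim_reduced_homology_quota_complex) auto
      also have "real \<dots> = (\<Sum>J\<in>{J. J \<subseteq> {1..N} \<and> card J = Suc p}. indicat_real (?A q) (\<Sum>i\<in>J. X i \<omega>))"
      proof -
        have fin: "finite {J. J \<subseteq> {1..N} \<and> card J = Suc p}" by simp
        show ?thesis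
          unfolding real_of_card sum.inter_filter[OF fin]
          by (intro sum.cong refl) (auto simp: indicator_def)
      qed
      finally show "real (dim_reduced_homology (\<X> q \<omega>) p) =
          (\<Sum>J\<in>{J. J \<subseteq> {1..N} \<and> card J = Suc p}. indicat_real (?A q) (\<Sum>i\<in>J. X i \<omega>))" .
    qed
  qed
  \<comment> \<open>Since \<open>M\<close> need not be complete, an almost sure identity does not
    give measurability; it is shown for the dimension itself.\<close>
  have meas_dim: "(\<lambda>\<omega>. real (dim_reduced_homology (\<X> q \<omega>) p)) \<in> borel_measurable M" for q p
    unfolding assms using X by (rule measurable_quota_complex[of N X M "\<lambda>K. real (dim_reduced_homology K p)"])
  have dim: "integrable M (\<lambda>\<omega>. real (dim_reduced_homology (\<X> q \<omega>) (j - 1))) \<and>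
      (\<integral>\<omega>. real (dim_reduced_homology (\<X> q \<omega>) (j - 1)) \<partial>M) = B j q" if j: "1 \<le> j" for j q
  proof -
    let ?s = "\<lambda>\<omega>. \<Sum>J\<in>{J. J \<subseteq> {1..N} \<and> card J = j}. indicat_real (?A q) (\<Sum>i\<in>J. X i \<omega>) :: real"
    have AE: "AE \<omega> in M. real (dim_reduced_homology (\<X> q \<omega>) (j - 1)) = ?s \<omega>"
    proof -
      obtain p where p: "j = Suc p" using j by (cases j) auto
      show ?thesis using dim_AE unfolding p diff_Suc_1 by (rule eventually_mono) blast
    qed
    have s: "integrable M ?s" "(\<integral>\<omega>. ?s \<omega> \<partial>M) = B j q"
      using G_eq sub[OF _ j] unfolding B by auto
    show ?thesis
      using integrable_cong_AE[OF meas_dim borel_measurable_integrable[OF s(1)] AE]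
        integral_cong_AE[OF meas_dim borel_measurable_integrable[OF s(1)] AE] s
      by simp
  qed
  have cont_B: "continuous_on UNIV (B j)" if "1 \<le> j" for j
    unfolding B using sub[OF _ that] cont_G by (intro continuous_on_sum) auto
  have compact_B: "compact (fun_support (B j))" if "1 \<le> j" for j
    unfolding B using R sub[OF _ that] by (intro compact_fun_support[of "-R" R] sum.neutral) auto

  \<comment> \<open>Expected Euler characteristic\<close>
  have euler: "integrable M (\<lambda>\<omega>. real_of_int (euler_char (\<X> q \<omega>))) \<and>
      1 - (\<integral>\<omega>. real_of_int (euler_char (\<X> q \<omega>)) \<partial>M) = (\<Sum>J\<in>\<J>. (-1) ^ card J * G J q)"
    if q: "m < q" for q
  proof -
    let ?s = "\<lambda>\<omega>. \<Sum>J\<in>\<J>. (-1) ^ card J * indicat_real (?A q) (\<Sum>i\<in>J. X i \<omega>) :: real"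
    \<comment> \<open>This holds for every outcome: the cancellation removes only the vertex 0,
      whose weight is constantly \<open>m\<close>.\<close>
    have eq: "real_of_int (euler_char (\<X> q \<omega>)) = 1 - ?s \<omega>" if "\<omega> \<in> space M" for \<omega>
    proof -
      have "1 - euler_char (\<X> q \<omega>) =
          (\<Sum>J\<in>\<J>. if (\<Sum>i\<in>J. X i \<omega>) \<in> ?A q then (-1) ^ card J else 0)"
        unfolding assms \<J>_def using X0[OF that] \<open>m > 0\<close> q by (intro euler_char_quota_complex) auto
      also have "real_of_int \<dots> = ?s \<omega>"
        unfolding of_int_sum by (intro sum.cong refl) (auto simp: indicator_def)
      finally show ?thesis by simp
    qed
    have s: "integrable M ?s" "(\<integral>\<omega>. ?s \<omega> \<partial>M) = (\<Sum>J\<in>\<J>. (-1) ^ card J * G J q)"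
      using G_eq by auto
    have "integrable M (\<lambda>\<omega>. real_of_int (euler_char (\<X> q \<omega>))) \<longleftrightarrow> integrable M (\<lambda>\<omega>. 1 - ?s \<omega>)"
      using eq by (intro Bochner_Integration.integrable_cong) auto
    moreover have "(\<integral>\<omega>. real_of_int (euler_char (\<X> q \<omega>)) \<partial>M) = (\<integral>\<omega>. 1 - ?s \<omega> \<partial>M)"
      using eq by (intro Bochner_Integration.integral_cong) auto
    ultimately show ?thesis
      using s by (simp add: prob_space)
  qed

  \<comment> \<open>The integral formula\<close>
  define K where "K J q \<alpha> = exp (2 * pi * \<i> * \<alpha> * q) * (1 - exp (- 2 * pi * \<i> * \<alpha> * m)) / \<alpha> *
      char (density lborel (\<lambda>x. ennreal (conv_family f J x))) (- 2 * pi * \<alpha>)" for J and q \<alpha> :: real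
  have K: "integrable lborel (K J q)" "(CLINT \<alpha>|lborel. K J q \<alpha>) = 2 * pi * \<i> * G J q"
    if "J \<in> \<J>" for J q
  proof -
    have "prob_space (density lborel (\<lambda>x. ennreal (conv_family f J x)))"
      using S[OF that] unfolding distr_S[OF that, symmetric] by (rule prob_space_distr)
    then show "integrable lborel (K J q)" "(CLINT \<alpha>|lborel. K J q \<alpha>) = 2 * pi * \<i> * G J q"
      using fourier_inversion_indicator[OF bump_J[OF that] _ m] unfolding K_def G_def by auto
  qed
  have integrand: "euler_integrand N m f q = (\<lambda>\<alpha>. \<Sum>J\<in>\<J>. (-1) ^ card J * K J q \<alpha>)" for q
  proof
    fix \<alpha>
    let ?F = "\<lambda>j. fourier_family m f j \<alpha>"
    \<comment> \<open>By independence the product of the transforms is the transform of the sum,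
      whose density is the convolution.\<close>
    have prod: "(\<Prod>j\<in>J. ?F j) = char (density lborel (\<lambda>x. ennreal (conv_family f J x))) (- 2 * pi * \<alpha>)"
      if "J \<in> \<J>" for J
    proof -
      have "?F j = char (distr M borel (X j)) (- 2 * pi * \<alpha>)" if "j \<in> J" for j
      proof -
        have j: "j \<in> {1..N}" using that \<J>(3)[OF \<open>J \<in> \<J>\<close>] by auto
        then show ?thesis
          using fourier_eq_char[of M "X j" "f j"] meas_f[OF j] assms
          by (simp add: fourier_family_def)
      qed
      then show ?thesis
        unfolding distr_S[OF that, symmetric] char_distr_sum[OF indep[OF that]] by simp
    qed
    have "{0..N} = insert 0 {1..N}" by auto
    then have "(\<Prod>j=0..N. 1 - ?F j) = (1 - ?F 0) * (\<Prod>j=1..N. 1 - ?F j)"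
      by simp
    also have "(\<Prod>j=1..N. 1 - ?F j) = (\<Sum>J\<in>Pow {1..N}. (-1) ^ card J * (\<Prod>j\<in>J. ?F j))"
      by (rule prod_one_minus) simp
    \<comment> \<open>The 1 comes from the empty subset; multiplied by \<open>1 - ?F 0\<close>, it
      is the term that the integrand subtracts.\<close>
    also have "\<dots> = 1 + (\<Sum>J\<in>\<J>. (-1) ^ card J * (\<Prod>j\<in>J. ?F j))"
      unfolding \<J>_def by (subst sum.remove[of _ "{}"]) auto
    finally have "(\<Prod>j=0..N. 1 - ?F j) - (1 - ?F 0) =
        (1 - ?F 0) * (\<Sum>J\<in>\<J>. (-1) ^ card J * (\<Prod>j\<in>J. ?F j))"
      by (simp add: algebra_simps)
    also have "\<dots> = (1 - exp (- 2 * pi * \<i> * \<alpha> * m)) * (\<Sum>J\<in>\<J>. (-1) ^ card J *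
        char (density lborel (\<lambda>x. ennreal (conv_family f J x))) (- 2 * pi * \<alpha>))"
      using prod by (simp add: fourier_family_def)
    finally show "euler_integrand N m f q \<alpha> = (\<Sum>J\<in>\<J>. (-1) ^ card J * K J q \<alpha>)"
      unfolding euler_integrand_def K_def
      by (simp add: sum_distrib_left sum_divide_distrib mult_ac)
  qed
  have int_integrand: "integrable lborel (euler_integrand N m f q)" for q
    unfolding integrand using K by auto
  \<comment> \<open>An identity for all real \<open>q\<close>: the integral inherits continuity and
    bounded support from the finitely many \<open>G J\<close>, and agrees with the expectation for
    \<open>q > m\<close>.\<close>
  have euler_eq: "euler_integral N m f = (\<lambda>q. complex_of_real (\<Sum>J\<in>\<J>. (-1) ^ card J * G J q))"
  proof
    fix q
    have "(CLINT \<alpha>|lborel. euler_integrand N m f q \<alpha>) = (\<Sum>J\<in>\<J>. (-1) ^ card J * (2 * pi * \<i> * G J q))"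
      unfolding integrand using K by simp
    also have "\<dots> = 2 * pi * \<i> * complex_of_real (\<Sum>J\<in>\<J>. (-1) ^ card J * G J q)"
      by (simp add: sum_distrib_left mult_ac)
    finally show "euler_integral N m f q = complex_of_real (\<Sum>J\<in>\<J>. (-1) ^ card J * G J q)"
      by (simp add: euler_integral_def)
  qed
  have "continuous_on UNIV (euler_integral N m f)"
    unfolding euler_eq using cont_G by (intro continuous_intros) auto
  moreover have "compact (fun_support (euler_integral N m f))"
    unfolding euler_eq using R by (intro compact_fun_support[of "-R" R]) simp
  moreover have "complex_of_real (1 - (\<integral>\<omega>. real_of_int (euler_char (\<X> q \<omega>)) \<partial>M)) = euler_integral N m f q"
    if "m < q" for q
    using euler[OF that] unfolding euler_eq by simp
  ultimately show ?thesis
    using dim cont_B compact_B euler int_integrand by blast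
qed

end
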